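(* Let $T$ be a countable forest. (i) If $T$ is strongly contracting, has no finite dominating set, and $T\notin\mathcal{T}^*$, then $T$ is Ramsey-cofinite. (ii) If $T$ is weakly expanding, or has a finite dominating set, or $T\in\mathcal{T}^*$, then $T$ is not Ramsey-lower-dense (and hence not Ramsey-cofinite).
   Context: $K_{\mathbb{N}}$ is the complete graph on $\mathbb{N}=\{1,2,\dots\}$; a copy of $G$ is a subgraph of $K_\mathbb{N}$ isomorphic to $G$, monochromatic if all its edges have the same color. Lower density: $\underline{d}(V)=\liminf_{t\to\infty}|V\cap\{1,\dots,t\}|/t$. $G$ is Ramsey-cofinite if in every 2-coloring of the edges of $K_\mathbb{N}$ there is a monochromatic copy of $G$ whose vertex set is cofinite in $\mathbb{N}$. $G$ is Ramsey-lower-dense if in every 2-coloring of $K_\mathbb{N}$ there is a monochromatic copy of $G$ whose vertex set has positive lower density. $G$ is weakly expanding if for every $k\in\mathbb{N}$ there is $\ell\in\mathbb{N}$ such that every independent set $A$ of $G$ with $|A|\ge\ell$ satisfies $|N(A)|>k$, where $N(A)=\bigcup_{v\in A}N(v)$. $G$ is strongly contracting if there is $k\in\mathbb{N}$ such that for every $\ell\in\mathbb{N}$ there is an independent set $A$ with $|A|\ge\ell$ and $|N(A)|\le k$. A set $X\subseteq V(G)$ is dominating if every vertex outside $X$ has a neighbor in $X$. $\mathcal{T}^*$ is the family of forests $T$ having a vertex $t$ of infinite degree such that, for some $d\in\mathbb{N}$, every other vertex has degree at most $d$, $t$ is adjacent to infinitely many leaves and infinitely many non-leaves, and all but finitely many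 vertices of $T$ are at distance at most $2$ from $t$. *)

theory Defs
  imports Complex_Main "HOL-Library.Extended_Real" "HOL-Library.Liminf_Limsup" "HOL-Library.Countable_Set"
begin

definition simple_graph :: "'a set \<Rightarrow> ('a \<Rightarrow> 'a \<Rightarrow> bool) \<Rightarrow> bool" where
  "simple_graph V E \<longleftrightarrow> (\<forall>u v. E u v \<longrightarrow> u \<in> V \<and> v \<in> V \<and> u \<noteq> v \<and> E v u)"

definition is_cycle :: "'a set \<Rightarrow> ('a \<Rightarrow> 'a \<Rightarrow> bool) \<Rightarrow> 'a list \<Rightarrow> bool" where
  "is_cycle V E xs \<longleftrightarrow> length xs \<ge> 3 \<and> distinct xs \<and> set xs \<subseteq> V \<and>
     (\<forall>i. Suc i < length xs \<longrightarrow> E (xs ! i) (xs ! Suc i)) \<and> E (last xs) (hd xs)"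

definition forest :: "'a set \<Rightarrow> ('a \<Rightarrow> 'a \<Rightarrow> bool) \<Rightarrow> bool" where
  "forest V E \<longleftrightarrow> simple_graph V E \<and> (\<nexists>xs. is_cycle V E xs)"

definition nbhd :: "('a \<Rightarrow> 'a \<Rightarrow> bool) \<Rightarrow> 'a \<Rightarrow> 'a set" where
  "nbhd E v = {u. E v u}"

definition nbhd_set :: "('a \<Rightarrow> 'a \<Rightarrow> bool) \<Rightarrow> 'a set \<Rightarrow> 'a set" where
  "nbhd_set E A = (\<Union>v\<in>A. nbhd E v)"

definition independent :: "'a set \<Rightarrow> ('a \<Rightarrow> 'a \<Rightarrow> bool) \<Rightarrow> 'a set \<Rightarrow> bool" where
  "independent V E A \<longleftrightarrow> A \<subseteq> V \<and> (\<forall>u\<in>A. \<forall>v\<in>A. \<not> E u v)"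

definition card_ge :: "'a set \<Rightarrow> nat \<Rightarrow> bool" where
  "card_ge A l \<longleftrightarrow> infinite A \<or> card A \<ge> l"

definition weakly_expanding :: "'a set \<Rightarrow> ('a \<Rightarrow> 'a \<Rightarrow> bool) \<Rightarrow> bool" where
  "weakly_expanding V E \<longleftrightarrow> (\<forall>k::nat. \<exists>l::nat. \<forall>A. independent V E A \<and> card_ge A l
      \<longrightarrow> card_ge (nbhd_set E A) (Suc k))"

definition strongly_contracting :: "'a set \<Rightarrow> ('a \<Rightarrow> 'a \<Rightarrow> bool) \<Rightarrow> bool" where
  "strongly_contracting V E \<longleftrightarrow> (\<exists>k::nat. \<forall>l::nat. \<exists>A. independent V E A \<and> card_ge A l
      \<and> finite (nbhd_set E A) \<and> card (nbhd_set E A) \<le> k)"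

definition dominating :: "'a set \<Rightarrow> ('a \<Rightarrow> 'a \<Rightarrow> bool) \<Rightarrow> 'a set \<Rightarrow> bool" where
  "dominating V E X \<longleftrightarrow> X \<subseteq> V \<and> (\<forall>v\<in>V - X. \<exists>x\<in>X. E v x)"

definition has_finite_dominating_set :: "'a set \<Rightarrow> ('a \<Rightarrow> 'a \<Rightarrow> bool) \<Rightarrow> bool" where
  "has_finite_dominating_set V E \<longleftrightarrow> (\<exists>X. finite X \<and> dominating V E X)"

definition is_leaf :: "('a \<Rightarrow> 'a \<Rightarrow> bool) \<Rightarrow> 'a \<Rightarrow> bool" where
  "is_leaf E v \<longleftrightarrow> finite (nbhd E v) \<and> card (nbhd E v) = 1"

definition in_T_star :: "'a set \<Rightarrow> ('a \<Rightarrow> 'a \<Rightarrow> bool) \<Rightarrow> bool" where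
  "in_T_star V E \<longleftrightarrow> forest V E \<and> (\<exists>t\<in>V.
      infinite (nbhd E t) \<and>
      (\<exists>d::nat. \<forall>v\<in>V - {t}. finite (nbhd E v) \<and> card (nbhd E v) \<le> d) \<and>
      infinite {v. E t v \<and> is_leaf E v} \<and>
      infinite {v. E t v \<and> \<not> is_leaf E v} \<and>
      finite {v\<in>V. \<not> (v = t \<or> E t v \<or> (\<exists>w. E t w \<and> E w v))})"

text \<open>Edge 2-colourings of K_N, N = {1,2,...}: a colour (bool) for every 2-element set {x,y}.
  A copy of G = (V,E) in K_N is given by an injection f : V \<rightarrow> {1,2,...}; its vertex set is
  f ` V and its edges are {f u, f v} for E u v. It is monochromatic of colour b if all
  these edges have colour b.\<close>
definition mono_copy :: "'a set \<Rightarrow> ('a \<Rightarrow> 'a \<Rightarrow> bool) \<Rightarrow> (nat set \<Rightarrow> bool) \<Rightarrow> ('a \<Rightarrow> nat) \<Rightarrow> bool" where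
  "mono_copy V E c f \<longleftrightarrow> inj_on f V \<and> f ` V \<subseteq> {1..} \<and>
     (\<exists>b. \<forall>u v. E u v \<longrightarrow> c {f u, f v} = b)"

definition lower_density :: "nat set \<Rightarrow> ereal" where
  "lower_density S = liminf (\<lambda>t::nat. ereal (real (card (S \<inter> {1..t})) / real t))"

definition ramsey_cofinite :: "'a set \<Rightarrow> ('a \<Rightarrow> 'a \<Rightarrow> bool) \<Rightarrow> bool" where
  "ramsey_cofinite V E \<longleftrightarrow> (\<forall>c. \<exists>f. mono_copy V E c f \<and> finite ({1..} - f ` V))"

definition ramsey_lower_dense :: "'a set \<Rightarrow> ('a \<Rightarrow> 'a \<Rightarrow> bool) \<Rightarrow> bool" where
  "ramsey_lower_dense V E \<longleftrightarrow> (\<forall>c. \<exists>f. mono_copy V E c f \<and> lower_density (f ` V) > 0)"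

end

(*
Part (ii). Split the positive integers into consecutive blocks, each much longer than everything
before it, and let the colour of {x < y} depend only on the blocks of x and y: on the parity of the
block of x if T is weakly expanding, of the block of y if T has a finite dominating set, and on a
period-4 pattern if T is in T*. In each case a monochromatic copy of T misses almost all of
infinitely many blocks.

Part (i). A strongly contracting forest has infinitely many isolated vertices or vertices with
arbitrarily many leaf neighbours. If infinitely many integers have finite degree in one colour, they
contain an infinite clique of the other colour whose vertices are joined to almost everything in that
other colour, and leaves attached to the clique cover the rest. Otherwise delete the finitely many
exceptions, so that all degrees in both colours are infinite and a parent-closed partial embedding can
always be extended greedily; it remains to cover a given integer.
If no finite set comes within bounded distance of every vertex of T, this is possible because one of
the colours stays connected after the deletion of any finite set. Otherwise T has a vertex s with
infinitely many non-leaf neighbours, of one of three types: branches of depth 3 at s, stars of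
unbounded size at neighbours of s, or a second vertex t with infinitely many leaves. Map s to any v.
The vertices missed by paths of length at most 2 from v form, for each colour b, a set
miss b v, joined to v in the other colour; if one of these two sets is finite, colour b does. If
both are infinite, then every element of one is joined to almost all of the other, in the colour by
which it is joined to v. This reaches the missed vertices by paths of length 3, by the stars, or by
the leaves of t.
*)

theory Submission
  imports Defs "HOL-Library.Ramsey"
begin

section \<open>Colourings without lower dense copies\<close>

lemma card_image_below:
  assumes "inj_on f W" "\<And>w. w \<in> W \<Longrightarrow> f w < (n::nat)"
  shows "finite W \<and> card W \<le> n"
proof -
  have "f ` W \<subseteq> {..<n}" using assms(2) by auto
  moreover from this have "finite (f ` W)" by (rule finite_subset) simp
  ultimately show ?thesis using assms(1)
    by (metis card_image card_lessThan card_mono finite_imageD finite_lessThan)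
qed

lemma lower_density_pos_if_cofinite:
  assumes "finite ({1..} - S)"
  shows "lower_density S > 0"
proof -
  define C where "C = card ({1..} - S)"
  have "\<forall>\<^sub>F t in sequentially. ereal (1/2) \<le> ereal (real (card (S \<inter> {1..t})) / real t)"
  proof (rule eventually_sequentiallyI)
    fix t :: nat assume t: "2 * C + 1 \<le> t"
    have "t = card ((S \<inter> {1..t}) \<union> ({1..t} - S))"
      by (metis Int_commute Int_Diff_Un card_atLeastAtMost diff_Suc_1)
    also have "\<dots> \<le> card (S \<inter> {1..t}) + card ({1..t} - S)" by (rule card_Un_le)
    also have "card ({1..t} - S) \<le> C" unfolding C_def by (rule card_mono[OF assms]) auto
    finally have "t \<le> card (S \<inter> {1..t}) + C" by simp
    then have "real t \<le> 2 * real (card (S \<inter> {1..t}))" using t by linarith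
    then show "ereal (1/2) \<le> ereal (real (card (S \<inter> {1..t})) / real t)"
      using t by (simp add: field_simps)
  qed
  then have "ereal (1/2) \<le> lower_density S"
    unfolding lower_density_def by (rule Liminf_bounded)
  moreover have "(0::ereal) < ereal (1/2)" by simp
  ultimately show ?thesis by (rule less_le_trans[rotated])
qed

lemma ramsey_cofinite_imp_lower_dense:
  "ramsey_cofinite V E \<Longrightarrow> ramsey_lower_dense V E"
  unfolding ramsey_cofinite_def ramsey_lower_dense_def
  using lower_density_pos_if_cofinite by blast

section \<open>Rapidly growing blocks of integers\<close>

primrec fast_seq :: "(nat \<Rightarrow> nat) \<Rightarrow> nat \<Rightarrow> nat" where
  "fast_seq G 0 = 0"
| "fast_seq G (Suc j) = Suc (fast_seq G j + Suc j * G (fast_seq G j))"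

text \<open>Block \<open>j\<close> consists of the integers from \<open>fast_seq G j\<close> up to,
  but excluding, \<open>fast_seq G (Suc j)\<close>. The factor \<open>Suc j\<close> in
  \<open>fast_seq\<close> makes \<open>G (fast_seq G j)\<close> at most the fraction 1/(j+1) of the
  last integer of block \<open>j\<close>. So \<open>G\<close> says how many elements a set may have
  up to the end of a block that it nearly misses.\<close>

definition block :: "(nat \<Rightarrow> nat) \<Rightarrow> nat \<Rightarrow> nat" where
  "block G x = (LEAST j. x < fast_seq G (Suc j))"

lemma fast_seq_mono: "strict_mono (fast_seq G)"
  by (simp add: strict_mono_Suc_iff)

lemma fast_seq_ge: "j \<le> fast_seq G j"
  using fast_seq_mono by (rule strict_mono_imp_increasing)

lemma block_upper: "x < fast_seq G (Suc (block G x))"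
  unfolding block_def by (rule LeastI[of _ x]) (metis fast_seq_ge Suc_le_lessD)

lemma less_fast_seq_iff: "x < fast_seq G j \<longleftrightarrow> block G x < j"
proof
  assume "x < fast_seq G j"
  then obtain i where "j = Suc i" by (cases j) auto
  then show "block G x < j"
    using \<open>x < fast_seq G j\<close> unfolding block_def by (auto simp: less_Suc_eq_le intro: Least_le)
next
  assume "block G x < j"
  then have "fast_seq G (Suc (block G x)) \<le> fast_seq G j"
    using fast_seq_mono[of G] by (metis Suc_leI strict_mono_less_eq)
  then show "x < fast_seq G j" using block_upper less_le_trans by blast
qed

lemma block_mono: "x \<le> y \<Longrightarrow> block G x \<le> block G y"
  using block_upper[of y G] less_fast_seq_iff[of x G "Suc (block G y)"] by simp

text \<open>At the last integer of block \<open>j\<close> the density of \<open>S\<close> is at most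
  1/(j+1), and by assumption this happens for arbitrarily large \<open>j\<close>.\<close>

lemma lower_density_zero:
  assumes "\<And>n. \<exists>j\<ge>n. card (S \<inter> {1..<fast_seq G (Suc j)}) \<le> G (fast_seq G j)"
  shows "\<not> lower_density S > 0"
proof
  assume "lower_density S > 0"
  then obtain e :: real where e: "e > 0" "ereal e < lower_density S"
    by (metis ereal_dense2 ereal_less(2))
  then have "\<forall>\<^sub>F t in sequentially. ereal e < ereal (real (card (S \<inter> {1..t})) / real t)"
    unfolding lower_density_def by (metis less_LiminfD)
  then obtain N where N: "\<And>t. t \<ge> N \<Longrightarrow> e < real (card (S \<inter> {1..t})) / real t"
    by (auto simp: eventually_sequentially)
  obtain m where m: "inverse (real (Suc m)) < e" using e(1) reals_Archimedean by blast
  obtain j where j: "j \<ge> max N m" "card (S \<inter> {1..<fast_seq G (Suc j)}) \<le> G (fast_seq G j)"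
    using assms by blast
  define t where "t = fast_seq G j + Suc j * G (fast_seq G j)"
  have "{1..<fast_seq G (Suc j)} = {1..t}" unfolding t_def by auto
  then have c: "card (S \<inter> {1..t}) \<le> G (fast_seq G j)" using j(2) by simp
  have tN: "t \<ge> N" using j(1) fast_seq_ge[of j G] unfolding t_def by simp
  have "real (Suc j) * real (card (S \<inter> {1..t})) \<le> real (Suc j) * real (G (fast_seq G j))"
    using c by (intro mult_left_mono) auto
  also have "\<dots> \<le> real t" unfolding t_def by (simp only: of_nat_mult of_nat_add)
  finally have le: "real (Suc j) * real (card (S \<inter> {1..t})) \<le> real t" .
  have "real (card (S \<inter> {1..t})) / real t \<le> inverse (real (Suc j))"
  proof (cases "t = 0")
    case False
    then show ?thesis using le by (simp add: field_simps)
  qed simp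
  also have "\<dots> \<le> inverse (real (Suc m))" using j(1) by (intro le_imp_inverse_le) auto
  finally show False using N[OF tN] m by linarith
qed

text \<open>An element of the copy below the end of block \<open>j\<close> lies before the block,
  where there is room for only \<open>fast_seq G j\<close> integers, or is the image of a vertex of
  \<open>W\<close>.\<close>

lemma mono_copy_block:
  assumes "inj_on f V" "f ` V \<subseteq> {1..}" and g: "\<And>v. v \<in> V \<Longrightarrow> block G (f v) = j \<Longrightarrow> v \<in> W"
    and "finite W" "W \<subseteq> V" "fast_seq G j + card W \<le> G (fast_seq G j)"
  shows "card (f ` V \<inter> {1..<fast_seq G (Suc j)}) \<le> G (fast_seq G j)"
proof -
  have "f ` V \<inter> {1..<fast_seq G (Suc j)} \<subseteq> {..<fast_seq G j} \<union> f ` W"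
  proof
    fix y assume "y \<in> f ` V \<inter> {1..<fast_seq G (Suc j)}"
    then obtain v where v: "v \<in> V" "y = f v" "block G y < Suc j" by (auto simp: less_fast_seq_iff simp del: fast_seq.simps)
    show "y \<in> {..<fast_seq G j} \<union> f ` W"
      using v g[of v] by (cases "block G y = j") (auto simp: less_fast_seq_iff)
  qed
  then have "card (f ` V \<inter> {1..<fast_seq G (Suc j)}) \<le> card ({..<fast_seq G j} \<union> f ` W)"
    using assms(4) by (intro card_mono) auto
  also have "\<dots> \<le> fast_seq G j + card (f ` W)" by (metis card_Un_le card_lessThan)
  also have "\<dots> \<le> fast_seq G j + card W" using assms(4) by (simp add: card_image_le)
  finally show ?thesis using assms(6) by simp
qed

section \<open>The three block colourings\<close>

definition pair_colouring :: "(nat \<Rightarrow> nat \<Rightarrow> bool) \<Rightarrow> nat set \<Rightarrow> bool" where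
  "pair_colouring g S = g (Min S) (Max S)"

lemma pair_colouring_less: "x < y \<Longrightarrow> pair_colouring g {x,y} = g x y"
  "x < y \<Longrightarrow> pair_colouring g {y,x} = g x y"
  by (auto simp: pair_colouring_def)

text \<open>An edge whose smaller end lies in block \<open>j\<close> has the colour given by the
  parity of \<open>j\<close>. If this parity is wrong for the copy, the vertices placed in block
  \<open>j\<close> have all their neighbours in earlier blocks, so they are independent with at most
  \<open>fast_seq G j\<close> neighbours; weak expansion then bounds their number.\<close>

lemma weakly_expanding_not_lower_dense:
  assumes "simple_graph V E" and we: "weakly_expanding V E"
  shows "\<not> ramsey_lower_dense V E"
proof -
  obtain l where l: "\<And>k A. independent V E A \<Longrightarrow> card_ge A (l k) \<Longrightarrow> card_ge (nbhd_set E A) (Suc k)"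
    using we unfolding weakly_expanding_def by metis
  \<comment> \<open>With \<open>k = fast_seq G j\<close>, at most \<open>k\<close> integers come
    before the block and fewer than \<open>l k\<close> vertices lie in it.\<close>
  define G where "G k = k + l k" for k
  let ?c = "pair_colouring (\<lambda>x y. even (block G x))"
  have "\<not> lower_density (f ` V) > 0" if f: "mono_copy V E ?c f" for f
  proof -
    obtain b where inj: "inj_on f V" and ran: "f ` V \<subseteq> {1..}"
      and b: "\<And>u v. E u v \<Longrightarrow> ?c {f u, f v} = b" using f unfolding mono_copy_def by blast
    have sg: "u \<in> V" "v \<in> V" "u \<noteq> v" "E v u" if "E u v" for u v
      using assms(1) that unfolding simple_graph_def by blast+
    have ne: "f u \<noteq> f v" if "E u v" for u v using sg[OF that] inj by (auto dest: inj_onD)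
    have small: "card (f ` V \<inter> {1..<fast_seq G (Suc j)}) \<le> G (fast_seq G j)" if j: "even j \<noteq> b" for j
    proof -
      define A where "A = {v\<in>V. block G (f v) = j}"
      have below: "f w < f u \<and> block G (f w) < j" if "u \<in> A" "E u w" for u w
      proof -
        have bu: "block G (f u) = j" using that by (simp add: A_def)
        have col: "even (block G (f x)) = b" if "E x y" "f x < f y" for x y
          using b[OF that(1)] that(2) by (simp add: pair_colouring_less)
        have lt: "f w < f u"
          using ne[OF that(2)] col[OF that(2)] bu j by (cases "f w < f u") auto
        then have "block G (f w) \<noteq> j" using col[OF sg(4)[OF that(2)]] j by auto
        then show ?thesis using lt block_mono[of "f w" "f u" G] bu by simp
      qed
      have "independent V E A"
        unfolding independent_def using below by (fastforce simp: A_def)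
      moreover have nb: "finite (nbhd_set E A) \<and> card (nbhd_set E A) \<le> fast_seq G j"
      proof (rule card_image_below)
        show "inj_on f (nbhd_set E A)"
          by (rule inj_on_subset[OF inj]) (auto simp: nbhd_set_def nbhd_def dest: sg)
        show "f w < fast_seq G j" if "w \<in> nbhd_set E A" for w
          using that below by (auto simp: nbhd_set_def nbhd_def less_fast_seq_iff)
      qed
      ultimately have "\<not> card_ge A (l (fast_seq G j))"
        using l[of A "fast_seq G j"] by (auto simp: card_ge_def)
      then have A: "finite A" "card A < l (fast_seq G j)" by (auto simp: card_ge_def)
      show ?thesis
        by (rule mono_copy_block[OF inj ran, where W = A]) (use A in \<open>auto simp: A_def G_def\<close>)
    qed
    show ?thesis
    proof (rule lower_density_zero)
      fix n show "\<exists>j\<ge>n. card (f ` V \<inter> {1..<fast_seq G (Suc j)}) \<le> G (fast_seq G j)"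
        using small[of n] small[of "Suc n"] by (cases "even n \<noteq> b") (metis order_refl, metis even_Suc le_SucI order_refl)
    qed
  qed
  then show ?thesis unfolding ramsey_lower_dense_def by blast
qed

text \<open>From some block on, every vertex outside the dominating set \<open>X\<close> has a
  smaller neighbour in \<open>X\<close>, and the edge to it has the colour of the vertex's own
  block. Later blocks of the wrong parity therefore receive no vertex outside
  \<open>X\<close>.\<close>

lemma finite_dominating_not_lower_dense:
  assumes "simple_graph V E" and "has_finite_dominating_set V E"
  shows "\<not> ramsey_lower_dense V E"
proof -
  obtain X where X: "finite X" "X \<subseteq> V" "\<And>v. v \<in> V \<Longrightarrow> v \<notin> X \<Longrightarrow> \<exists>x\<in>X. E v x"
    using assms(2) unfolding has_finite_dominating_set_def dominating_def by blast
  define G where "G k = k + card X" for k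
  let ?c = "pair_colouring (\<lambda>x y. even (block G y))"
  have "\<not> lower_density (f ` V) > 0" if f: "mono_copy V E ?c f" for f
  proof -
    obtain b where inj: "inj_on f V" and ran: "f ` V \<subseteq> {1..}"
      and b: "\<And>u v. E u v \<Longrightarrow> ?c {f u, f v} = b" using f unfolding mono_copy_def by blast
    obtain m where m: "\<And>x. x \<in> X \<Longrightarrow> block G (f x) < m"
      using finite_nat_bounded[of "(\<lambda>x. block G (f x)) ` X"] X(1) by (auto simp: image_subset_iff)
    have small: "card (f ` V \<inter> {1..<fast_seq G (Suc j)}) \<le> G (fast_seq G j)"
      if j: "even j \<noteq> b" "m \<le> j" for j
    proof (rule mono_copy_block[OF inj ran, where W = X])
      fix v assume v: "v \<in> V" "block G (f v) = j"
      show "v \<in> X"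
      proof (rule ccontr)
        assume "v \<notin> X"
        then obtain x where x: "x \<in> X" "E v x" using X(3) v(1) by blast
        have "f x < f v"
          using m[OF x(1)] j(2) v(2) block_mono[of "f v" "f x" G] by linarith
        then show False using b[OF x(2)] v(2) j(1) by (simp add: pair_colouring_less)
      qed
    qed (use X in \<open>auto simp: G_def\<close>)
    show ?thesis
    proof (rule lower_density_zero)
      fix n show "\<exists>j\<ge>n. card (f ` V \<inter> {1..<fast_seq G (Suc j)}) \<le> G (fast_seq G j)"
        using small[of "n+m"] small[of "Suc (n+m)"]
        by (cases "even (n+m) \<noteq> b") (metis le_add1 le_add2, metis even_Suc le_Suc_eq le_add1 le_add2)
    qed
  qed
  then show ?thesis unfolding ramsey_lower_dense_def by blast
qed

text \<open>Neighbours of \<open>t\<close> in blocks above that of \<open>t\<close> lie in blocks of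
  a single parity \<open>q\<close>. In a suitable block \<open>j\<close> of the other parity, a
  vertex \<open>v\<close> that is neither \<open>t\<close> nor far has a neighbour \<open>w\<close>
  adjacent to \<open>t\<close>. If \<open>w\<close> lies in an earlier block, \<open>v\<close> is
  one of boundedly many neighbours of earlier vertices. If \<open>w\<close> lies in a later block,
  that block has parity \<open>q\<close>, and the residue of \<open>j\<close> modulo 4 gives the
  edge between \<open>v\<close> and \<open>w\<close> the wrong colour.\<close>

lemma T_star_not_lower_dense:
  assumes "in_T_star V E"
  shows "\<not> ramsey_lower_dense V E"
proof -
  have "simple_graph V E" using assms by (simp add: in_T_star_def forest_def)
  then have sg: "u \<in> V" "v \<in> V" "u \<noteq> v" "E v u" if "E u v" for u v
    using that unfolding simple_graph_def by blast+
  obtain t d where t: "t \<in> V"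
    and d: "\<And>v. v \<in> V \<Longrightarrow> v \<noteq> t \<Longrightarrow> finite (nbhd E v) \<and> card (nbhd E v) \<le> d"
    and far: "finite {v\<in>V. \<not> (v = t \<or> E t v \<or> (\<exists>w. E t w \<and> E w v))}"
    using assms unfolding in_T_star_def by blast
  define Far where "Far = {v\<in>V. \<not> (v = t \<or> E t v \<or> (\<exists>w. E t w \<and> E w v))}"
  \<comment> \<open>The summands count the earlier integers, \<open>t\<close>, the far vertices, and
    the neighbours of at most \<open>k\<close> earlier vertices of degree at most
    \<open>d\<close>.\<close>
  define G where "G k = k + (Suc (card Far) + k * d)" for k
  let ?c = "pair_colouring (\<lambda>x y. even (block G y) \<longleftrightarrow> block G x mod 4 < 2)"
  have "\<not> lower_density (f ` V) > 0" if f: "mono_copy V E ?c f" for f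
  proof -
    obtain b where inj: "inj_on f V" and ran: "f ` V \<subseteq> {1..}"
      and b: "\<And>u v. E u v \<Longrightarrow> ?c {f u, f v} = b" using f unfolding mono_copy_def by blast
    have col: "(even (block G (f v)) \<longleftrightarrow> block G (f u) mod 4 < 2) = b"
      if "E u v" "block G (f u) < block G (f v)" for u v
    proof -
      have "f u < f v" using that(2) block_mono[of "f v" "f u" G] by linarith
      then show ?thesis using b[OF that(1)] by (simp add: pair_colouring_less)
    qed
    define q where "q \<longleftrightarrow> (block G (f t) mod 4 < 2) = b"
    have small: "card (f ` V \<inter> {1..<fast_seq G (Suc j)}) \<le> G (fast_seq G j)"
      if j: "block G (f t) < j" "even j \<noteq> q" "(q \<longleftrightarrow> j mod 4 < 2) \<noteq> b" for j
    proof -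
      define W where "W = {w\<in>V. w \<noteq> t \<and> f w < fast_seq G j}"
      have W: "finite W \<and> card W \<le> fast_seq G j"
        by (rule card_image_below[OF inj_on_subset[OF inj]]) (auto simp: W_def)
      have "card (\<Union>w\<in>W. nbhd E w) \<le> (\<Sum>w\<in>W. card (nbhd E w))"
        using W by (intro card_UN_le) simp
      also have "\<dots> \<le> (\<Sum>w\<in>W. d)" by (rule sum_mono) (use d in \<open>auto simp: W_def\<close>)
      also have "\<dots> \<le> fast_seq G j * d" using W by simp
      finally have cW: "card (\<Union>w\<in>W. nbhd E w) \<le> fast_seq G j * d" .
      have fW: "finite (\<Union>w\<in>W. nbhd E w)" using W d by (auto simp: W_def)
      define W' where "W' = insert t Far \<union> (\<Union>w\<in>W. nbhd E w)"
      have "card W' \<le> card (insert t Far) + card (\<Union>w\<in>W. nbhd E w)" unfolding W'_def by (rule card_Un_le)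
      also have "\<dots> \<le> Suc (card Far) + fast_seq G j * d"
        using cW card_insert_le_m1[of "Suc (card Far)" Far t] by (auto intro: add_mono)
      finally have cW': "card W' \<le> Suc (card Far) + fast_seq G j * d" .
      show ?thesis
      proof (rule mono_copy_block[OF inj ran, where W = W'])
        fix v assume v: "v \<in> V" "block G (f v) = j"
        have noadj: "block G (f w) \<noteq> j" if "E t w" for w
          using col[OF that] j by (auto simp: q_def)
        show "v \<in> W'"
        proof (rule ccontr)
          assume vW: "v \<notin> W'"
          then have "v \<noteq> t" "\<not> E t v" using noadj v by (auto simp: W'_def)
          then obtain w where w: "E t w" "E w v" using vW v(1) by (auto simp: W'_def Far_def)
          have wt: "w \<noteq> t" "w \<in> V" using w(1) sg by blast+
          then have "\<not> f w < fast_seq G j" using vW w(2) by (auto simp: W'_def W_def nbhd_def)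
          then have gt: "j < block G (f w)" using noadj[OF w(1)] by (simp add: less_fast_seq_iff)
          have "even (block G (f w)) = q" using col[OF w(1)] gt j(1) by (auto simp: q_def)
          moreover have "(even (block G (f w)) \<longleftrightarrow> j mod 4 < 2) = b"
            using col[OF sg(4)[OF w(2)]] gt v(2) by simp
          ultimately show False using j(3) by simp
        qed
      next
        show "finite W'" using fW far by (simp add: W'_def Far_def)
        show "W' \<subseteq> V" using t sg by (auto simp: W'_def Far_def nbhd_def)
        show "fast_seq G j + card W' \<le> G (fast_seq G j)" using cW' by (simp add: G_def)
      qed
    qed
    show ?thesis
    proof (rule lower_density_zero)
      fix n :: nat
      \<comment> \<open>Parity and the condition \<open>r < 2\<close> are independent on the
        residues modulo 4, so both requirements on \<open>j\<close> can be met at once.\<close>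
      obtain r :: nat where r: "r < 4" "even r \<noteq> q" "(q \<longleftrightarrow> r < 2) \<noteq> b"
      proof -
        have "\<exists>r::nat. r < 4 \<and> even r = p \<and> (r < 2) = p'" for p p'
          by (rule exI[of _ "if p then if p' then 0 else 2 else if p' then 1 else 3"]) auto
        from this[of "\<not> q" "q \<noteq> b"] show ?thesis using that by auto
      qed
      define j where "j = 4 * (n + Suc (block G (f t))) + r"
      have "j mod 4 = r" "even j = even r" using r(1) unfolding j_def by (simp only: mod_mult_self4 mod_less, simp)
      then have "card (f ` V \<inter> {1..<fast_seq G (Suc j)}) \<le> G (fast_seq G j)"
        using small[of j] r by (simp add: j_def del: fast_seq.simps)
      moreover have "n \<le> j" by (simp add: j_def)
      ultimately show "\<exists>j\<ge>n. card (f ` V \<inter> {1..<fast_seq G (Suc j)}) \<le> G (fast_seq G j)" by blast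
    qed
  qed
  then show ?thesis unfolding ramsey_lower_dense_def by blast
qed

section \<open>Rooting a forest\<close>

text \<open>\<open>\<delta>\<close> is the depth and \<open>\<pi>\<close> the parent map, whose value at a root (\<open>\<delta> v = 0\<close>) is junk.\<close>

definition rooting :: "'a set \<Rightarrow> ('a \<Rightarrow> 'a \<Rightarrow> bool) \<Rightarrow> ('a \<Rightarrow> 'a) \<Rightarrow> ('a \<Rightarrow> nat) \<Rightarrow> bool" where
  "rooting V E \<pi> \<delta> \<longleftrightarrow>
     (\<forall>v\<in>V. \<delta> v \<noteq> 0 \<longrightarrow> \<pi> v \<in> V \<and> \<delta> v = Suc (\<delta> (\<pi> v)) \<and> E v (\<pi> v)) \<and>
     (\<forall>u v. E u v \<longrightarrow> \<delta> u \<noteq> 0 \<and> \<pi> u = v \<or> \<delta> v \<noteq> 0 \<and> \<pi> v = u)"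

text \<open>If the vertex to be put in front already occurs in the path, the part of the path from
  that occurrence on is taken instead.\<close>

lemma rtranclp_distinct_path:
  assumes "R\<^sup>*\<^sup>* x y"
  shows "\<exists>xs. distinct xs \<and> successively R xs \<and> xs \<noteq> [] \<and> hd xs = x \<and> last xs = y"
  using assms
proof (induction rule: converse_rtranclp_induct)
  case base
  show ?case by (rule exI[of _ "[y]"]) auto
next
  case (step x x')
  then obtain xs where xs: "distinct xs" "successively R xs" "xs \<noteq> []" "hd xs = x'" "last xs = y"
    by blast
  show ?case
  proof (cases "x \<in> set xs")
    case True
    then obtain as bs where ab: "xs = as @ x # bs" by (meson split_list)
    then have "distinct (x # bs)" "successively R (x # bs)" "last (x # bs) = y"
      using xs by (auto simp: successively_append_iff)
    then show ?thesis by (metis list.distinct(1) list.sel(1))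
  next
    case False
    then have "distinct (x # xs)" "successively R (x # xs)" "last (x # xs) = y"
      using xs step(1) by (auto simp: successively_Cons)
    then show ?thesis by (metis list.distinct(1) list.sel(1))
  qed
qed

text \<open>Otherwise a path inside \<open>S\<close> from \<open>u\<close> to \<open>w\<close>,
  closed up through \<open>v\<close>, is a cycle.\<close>

lemma forest_unique_nbr:
  assumes "forest V E" "v \<in> V" "v \<notin> S" "S \<subseteq> V" "u \<in> S" "E v u" "E v w"
    and conn: "(\<lambda>x y. E x y \<and> x \<in> S \<and> y \<in> S)\<^sup>*\<^sup>* u w"
  shows "u = w"
proof (rule ccontr)
  assume "u \<noteq> w"
  obtain xs where xs: "distinct xs" "successively (\<lambda>x y. E x y \<and> x \<in> S \<and> y \<in> S) xs"
      "xs \<noteq> []" "hd xs = u" "last xs = w"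
    using rtranclp_distinct_path[OF conn] by blast
  obtain ys where ys: "xs = u # ys" "ys \<noteq> []"
    using xs(3,4,5) \<open>u \<noteq> w\<close> by (metis last_ConsL list.collapse)
  have "set xs \<subseteq> S"
  proof
    fix x assume "x \<in> set xs"
    then obtain as bs where "xs = as @ x # bs" by (meson split_list)
    then show "x \<in> S" using xs(2,4) assms(5) by (cases as rule: rev_cases) (auto simp: successively_append_iff)
  qed
  moreover have "successively E (v # xs)"
    using xs(2) ys assms(6) by (auto simp: successively_Cons elim: successively_mono)
  moreover have "E (last (v # xs)) v"
    using assms(1,7) xs by (auto simp: forest_def simple_graph_def)
  ultimately have "is_cycle V E (v # xs)"
    using xs ys assms(2,3,4) unfolding is_cycle_def
    by (cases ys) (auto simp: successively_conv_nth)
  then show False using assms(1) unfolding forest_def by blast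
qed

text \<open>The depth is the distance to a root chosen in each component, namely \<open>s\<close> in
  the component of \<open>s\<close>. Every edge leads from a vertex to its parent, because a
  neighbour of \<open>v\<close> that is no deeper than \<open>v\<close> is connected to the parent
  of \<open>v\<close> through the root without using \<open>v\<close>.\<close>

lemma forest_rooting:
  assumes fo: "forest V E" and s: "s \<in> V"
  obtains \<pi> \<delta> where "rooting V E \<pi> \<delta>" "\<delta> s = 0"
proof -
  have sg: "u \<in> V" "v \<in> V" "u \<noteq> v" "E v u" if "E u v" for u v
    using fo that unfolding forest_def simple_graph_def by blast+
  have sym: "E\<^sup>*\<^sup>* v u" if "E\<^sup>*\<^sup>* u v" for u v
    using that by induction (auto intro: converse_rtranclp_into_rtranclp sg)
  \<comment> \<open>The choice depends only on the set of vertices reachable from \<open>v\<close>,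
    so it is constant on a component.\<close>
  define rt where "rt v = (if E\<^sup>*\<^sup>* v s then s else SOME x. E\<^sup>*\<^sup>* v x)" for v
  have rt: "E\<^sup>*\<^sup>* v (rt v)" for v
    unfolding rt_def by (auto intro: someI[of _ v])
  have rt_eq: "rt u = rt v" if "E\<^sup>*\<^sup>* u v" for u v
  proof -
    have "E\<^sup>*\<^sup>* u = E\<^sup>*\<^sup>* v"
      by (intro ext) (meson that sym[OF that] rtranclp_trans)
    then show ?thesis unfolding rt_def by simp
  qed
  define \<delta> where "\<delta> v = (LEAST n. (E ^^ n) (rt v) v)" for v
  have ex: "(E ^^ \<delta> v) (rt v) v" for v
    unfolding \<delta>_def by (rule LeastI_ex) (meson rt sym rtranclp_imp_relpowp)
  have le: "\<delta> v \<le> n" if "(E ^^ n) (rt v) v" for n v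
    unfolding \<delta>_def using that by (rule Least_le)
  have step: "\<delta> v \<le> Suc (\<delta> u)" if "E u v" for u v
    by (rule le) (metis ex[of u] that rt_eq[of u v] relpowp_Suc_I r_into_rtranclp)
  have zero: "rt v = v" if "\<delta> v = 0" for v
    using ex[of v] that by simp
  have par: "\<exists>u. E v u \<and> \<delta> v = Suc (\<delta> u)" if nz: "\<delta> v \<noteq> 0" for v
  proof -
    obtain m where m: "\<delta> v = Suc m" using nz by (cases "\<delta> v") auto
    then obtain u where u: "(E ^^ m) (rt v) u" "E u v" using ex[of v] by auto
    then have "\<delta> u \<le> m" using le[of m u] rt_eq[OF r_into_rtranclp[of E u v]] by simp
    then show ?thesis using step[OF u(2)] m sg(4)[OF u(2)] by auto
  qed
  then obtain \<pi> where \<pi>: "\<And>v. \<delta> v \<noteq> 0 \<Longrightarrow> E v (\<pi> v) \<and> \<delta> v = Suc (\<delta> (\<pi> v))" by metis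
  \<comment> \<open>\<open>D v\<close> is the graph on the vertices other than \<open>v\<close> of
    depth at most \<open>\<delta> v\<close>. Depth drops along a parent chain, so a chain starting
    there never meets \<open>v\<close>.\<close>
  define D where "D v x y \<longleftrightarrow> E x y \<and> x \<in> {y\<in>V. y \<noteq> v \<and> \<delta> y \<le> \<delta> v} \<and> y \<in> {y\<in>V. y \<noteq> v \<and> \<delta> y \<le> \<delta> v}" for v x y
  have D_root: "(D v)\<^sup>*\<^sup>* x (rt x)" if "x \<in> V" "x \<noteq> v" "\<delta> x \<le> \<delta> v" for v x
    using that
  proof (induction "\<delta> x" arbitrary: x)
    case 0
    then show ?case using zero[of x] by simp
  next
    case (Suc n)
    then have e: "E x (\<pi> x)" "\<delta> x = Suc (\<delta> (\<pi> x))" using \<pi>[of x] by auto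
    have "(D v)\<^sup>*\<^sup>* (\<pi> x) (rt (\<pi> x))"
      using Suc e sg[OF e(1)] by (intro Suc(1)) auto
    moreover have "D v x (\<pi> x)" using Suc e sg[OF e(1)] by (auto simp: D_def)
    moreover have "rt (\<pi> x) = rt x" using rt_eq[OF r_into_rtranclp[of E, OF e(1)]] by simp
    ultimately show ?case by (metis converse_rtranclp_into_rtranclp)
  qed
  have D_sym: "(D v)\<^sup>*\<^sup>* y x" if "(D v)\<^sup>*\<^sup>* x y" for v x y
    using that by induction (auto intro: converse_rtranclp_into_rtranclp simp: D_def dest: sg)
  have up: "\<delta> v \<noteq> 0 \<and> \<pi> v = u" if e: "E v u" "\<delta> u \<le> \<delta> v" for u v
  proof -
    have rteq: "rt u = rt v" using rt_eq[OF r_into_rtranclp[of E, OF e(1)]] by simp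
    then have nz: "\<delta> v \<noteq> 0" using zero[of u] zero[of v] sg(3)[OF e(1)] e(2) by auto
    then have p: "E v (\<pi> v)" "\<delta> v = Suc (\<delta> (\<pi> v))" using \<pi> by blast+
    have "(D v)\<^sup>*\<^sup>* u (rt v)" using D_root[of u v] sg[OF e(1)] e(2) rteq by simp
    moreover have "(D v)\<^sup>*\<^sup>* (\<pi> v) (rt v)"
      using D_root[of "\<pi> v" v] sg[OF p(1)] p rt_eq[OF r_into_rtranclp[of E, OF p(1)]] by simp
    ultimately have "(D v)\<^sup>*\<^sup>* u (\<pi> v)" by (meson D_sym rtranclp_trans)
    then have "u = \<pi> v"
      unfolding D_def
      by (intro forest_unique_nbr[OF fo, of v "{y\<in>V. y \<noteq> v \<and> \<delta> y \<le> \<delta> v}"]) (use sg[OF e(1)] e p in auto)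
    then show ?thesis using nz by simp
  qed
  have "rooting V E \<pi> \<delta>"
    unfolding rooting_def using \<pi> sg up by (metis nat_le_linear)
  moreover have "\<delta> s = 0" using le[of 0 s] by (simp add: rt_def)
  ultimately show thesis by (rule that)
qed

section \<open>Greedy extension of partial embeddings\<close>

text \<open>\<open>A\<close> will be one colour class, \<open>M\<close> the integers in play, and
  \<open>X\<close> the part of \<open>M\<close> that the copy has to cover.\<close>

definition spans :: "'a set \<Rightarrow> ('a \<Rightarrow> 'a \<Rightarrow> bool) \<Rightarrow> (nat \<Rightarrow> nat \<Rightarrow> bool) \<Rightarrow> nat set \<Rightarrow> nat set \<Rightarrow> bool" where
  "spans V E A M X \<longleftrightarrow>
     (\<exists>f. inj_on f V \<and> f ` V \<subseteq> M \<and> (\<forall>u v. E u v \<longrightarrow> A (f u) (f v)) \<and> X \<subseteq> f ` V)"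

locale rooted_forest =
  fixes V :: "'a set" and E :: "'a \<Rightarrow> 'a \<Rightarrow> bool" and \<pi> :: "'a \<Rightarrow> 'a" and \<delta> :: "'a \<Rightarrow> nat"
  assumes rooting: "rooting V E \<pi> \<delta>"
    and graph: "simple_graph V E"
    and countable_V: "countable V"
begin

definition kids :: "'a \<Rightarrow> 'a set" where
  "kids p = {u\<in>V. \<delta> u \<noteq> 0 \<and> \<pi> u = p}"

definition leaf_kids :: "'a \<Rightarrow> 'a set" where
  "leaf_kids p = {u\<in>kids p. kids u = {}}"

lemma parent:
  assumes "v \<in> V" "\<delta> v \<noteq> 0"
  shows "\<pi> v \<in> V" "\<delta> v = Suc (\<delta> (\<pi> v))" "E v (\<pi> v)"
  using rooting assms unfolding rooting_def by blast+

lemma edge_cases: "E u v \<Longrightarrow> u \<in> kids v \<or> v \<in> kids u"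
  using rooting graph unfolding rooting_def simple_graph_def kids_def by blast

lemma kids_edge: "u \<in> kids v \<Longrightarrow> E v u"
  using parent(3) graph unfolding kids_def simple_graph_def by blast

lemma kids_in: "u \<in> kids v \<Longrightarrow> u \<in> V \<and> v \<in> V \<and> \<delta> u = Suc (\<delta> v) \<and> \<pi> u = v"
  using parent by (auto simp: kids_def)

lemma ancestor:
  assumes "w \<in> V" "k \<le> \<delta> w"
  shows "(\<pi> ^^ k) w \<in> V \<and> \<delta> ((\<pi> ^^ k) w) = \<delta> w - k"
  using assms(2)
proof (induction k)
  case (Suc k)
  then have "(\<pi> ^^ k) w \<in> V" "\<delta> ((\<pi> ^^ k) w) \<noteq> 0" "\<delta> ((\<pi> ^^ k) w) = \<delta> w - k" by auto
  then show ?case using parent[of "(\<pi> ^^ k) w"] by simp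
qed (use assms in simp)

lemma nbhd_root: "\<delta> s = 0 \<Longrightarrow> nbhd E s = kids s"
  using edge_cases[of s] kids_edge[of _ s] kids_in[of s] by (fastforce simp: nbhd_def)

lemma nbhd_nonroot: "v \<in> V \<Longrightarrow> \<delta> v \<noteq> 0 \<Longrightarrow> nbhd E v = insert (\<pi> v) (kids v)"
  using edge_cases[of v] kids_edge parent(3) by (auto simp: nbhd_def kids_def)

end

text \<open>Vertices with children may only be placed in \<open>H\<close>; childless vertices go anywhere in \<open>M\<close>.\<close>

locale hosted_forest = rooted_forest V E \<pi> \<delta>
  for V :: "'a set" and E :: "'a \<Rightarrow> 'a \<Rightarrow> bool" and \<pi> :: "'a \<Rightarrow> 'a" and \<delta> :: "'a \<Rightarrow> nat" +
  fixes A :: "nat \<Rightarrow> nat \<Rightarrow> bool" and M H :: "nat set"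
  assumes sym_A: "A x y \<Longrightarrow> A y x"
    and H_sub: "H \<subseteq> M"
    and H_infinite: "infinite H"
    and H_degree: "h \<in> H \<Longrightarrow> infinite {y\<in>H. A h y}"
begin

text \<open>The domain is closed under parents, so no child of an unplaced vertex is placed, and a
  new vertex meets the old ones in at most the edge to its parent. A placed vertex with children
  sits in \<open>H\<close>, where infinitely many neighbours are available as images of
  these.\<close>

definition partial_emb :: "('a \<Rightarrow> nat option) \<Rightarrow> bool" where
  "partial_emb g \<longleftrightarrow> finite (dom g) \<and> dom g \<subseteq> V \<and> ran g \<subseteq> M \<and> inj_on g (dom g) \<and>
     (\<forall>v\<in>dom g. \<delta> v \<noteq> 0 \<longrightarrow> \<pi> v \<in> dom g) \<and>
     (\<forall>v y y'. \<delta> v \<noteq> 0 \<longrightarrow> g v = Some y \<longrightarrow> g (\<pi> v) = Some y' \<longrightarrow> A y y') \<and>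
     (\<forall>v y. g v = Some y \<longrightarrow> kids v \<noteq> {} \<longrightarrow> y \<in> H)"

lemma finite_ran_emb: "partial_emb g \<Longrightarrow> finite (ran g)"
  unfolding partial_emb_def by (simp add: finite_ran)

lemma parent_dom: "partial_emb g \<Longrightarrow> g v = Some y \<Longrightarrow> \<delta> v \<noteq> 0 \<Longrightarrow> \<exists>y'. g (\<pi> v) = Some y'"
  unfolding partial_emb_def by (meson domD domI)

lemma kids_fresh: "partial_emb g \<Longrightarrow> g p = None \<Longrightarrow> u \<in> kids p \<Longrightarrow> g u = None"
  by (cases "g u") (auto simp: kids_def dest: parent_dom)

lemma add_vertex:
  assumes g: "partial_emb g" and w: "w \<in> V" "g w = None" and y: "y \<in> M" "y \<notin> ran g" 
    and H: "y \<in> H \<or> kids w = {}"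
    and par: "\<delta> w \<noteq> 0 \<Longrightarrow> \<exists>y'. g (\<pi> w) = Some y' \<and> A y' y"
  shows "\<exists>g'. partial_emb g' \<and> g \<subseteq>\<^sub>m g' \<and> ran g' = insert y (ran g) \<and>
           dom g' = insert w (dom g) \<and> g' w = Some y"
proof -
  define g' where "g' = g(w \<mapsto> y)"
  have w': "g' w = Some y" and dom: "dom g' = insert w (dom g)" and ran: "ran g' = insert y (ran g)"
    using w(2) by (simp_all add: g'_def)
  have old: "g' v = g v" if "v \<noteq> w" for v using that by (simp add: g'_def)
  have "g \<subseteq>\<^sub>m g'" unfolding g'_def using w(2) by (auto simp: map_le_def)
  moreover have "partial_emb g'"
    unfolding partial_emb_def
  proof (intro conjI ballI allI impI)
    show "inj_on g' (dom g')"
    proof (rule inj_onI)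
      fix u v assume uv: "u \<in> dom g'" "v \<in> dom g'" "g' u = g' v"
      have "g u \<noteq> Some y" for u using y(2) by (auto simp: ran_def)
      then show "u = v"
        using uv g w' old[of u] old[of v] dom
        by (cases "u = w"; cases "v = w") (auto simp: partial_emb_def inj_on_def)
    qed
  next
    fix v assume "v \<in> dom g'" "\<delta> v \<noteq> 0"
    then show "\<pi> v \<in> dom g'" using dom par parent_dom[OF g, of v] by (cases "v = w") auto
  next
    fix v z z' assume v: "\<delta> v \<noteq> 0" "g' v = Some z" "g' (\<pi> v) = Some z'"
    show "A z z'"
    proof (cases "v = w")
      case True
      moreover have "\<pi> w \<noteq> w" using parent(2)[OF w(1)] v(1) True by auto
      ultimately show ?thesis using v par w' old[of "\<pi> v"] sym_A by auto
    next
      case False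
      then have "g v = Some z" using v(2) old by simp
      moreover from this have "\<pi> v \<noteq> w" using parent_dom[OF g] v(1) w(2) by force
      ultimately show ?thesis using g v old[of "\<pi> v"] unfolding partial_emb_def by auto
    qed
  next
    fix v z assume "g' v = Some z" "kids v \<noteq> {}"
    then show "z \<in> H" using g H w' old[of v] unfolding partial_emb_def by (cases "v = w") auto
  qed (use g w y dom ran in \<open>auto simp: partial_emb_def\<close>)
  ultimately show ?thesis using w' dom ran by blast
qed

lemma partial_emb_empty: "partial_emb Map.empty"
  by (simp add: partial_emb_def)

text \<open>Ancestors are placed first, by induction on depth, with fresh values outside
  \<open>Q\<close>. The bound on the depth of new vertices makes it possible to place the parent of
  a vertex and know that the vertex itself is still free.\<close>

lemma extend_vertex:
  assumes "partial_emb g" "v \<in> V" "finite Q"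
  shows "\<exists>g'. partial_emb g' \<and> g \<subseteq>\<^sub>m g' \<and> v \<in> dom g' \<and> ran g' \<inter> Q \<subseteq> ran g \<and>
           (\<forall>w\<in>dom g'. w \<in> dom g \<or> \<delta> w \<le> \<delta> v)"
  using assms(2)
proof (induction "\<delta> v" arbitrary: v)
  case 0
  show ?case
  proof (cases "g v")
    case None
    obtain y where y: "y \<in> H" "y \<notin> ran g \<union> Q"
      using H_infinite finite_ran_emb[OF assms(1)] assms(3)
      by (meson finite_UnI finite_subset subsetI)
    then obtain g' where "partial_emb g'" "g \<subseteq>\<^sub>m g'" "ran g' = insert y (ran g)" "dom g' = insert v (dom g)"
      using add_vertex[OF assms(1) 0(2) None, of y] 0(1) H_sub by auto
    then show ?thesis using y by (intro exI[of _ g']) auto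
  qed (use assms(1) in \<open>auto intro!: exI[of _ g]\<close>)
next
  case (Suc n)
  then have p: "\<pi> v \<in> V" "\<delta> v = Suc (\<delta> (\<pi> v))" using parent[of v] by auto
  then obtain g1 where g1: "partial_emb g1" "g \<subseteq>\<^sub>m g1" "\<pi> v \<in> dom g1" "ran g1 \<inter> Q \<subseteq> ran g"
      "\<forall>w\<in>dom g1. w \<in> dom g \<or> \<delta> w \<le> \<delta> (\<pi> v)"
    using Suc(1)[of "\<pi> v"] Suc(2) by auto
  show ?case
  proof (cases "g1 v")
    case None
    obtain y' where y': "g1 (\<pi> v) = Some y'" using g1(3) by auto
    have "v \<in> kids (\<pi> v)" using Suc by (auto simp: kids_def)
    then have "y' \<in> H" using g1(1) y' unfolding partial_emb_def by blast
    then have "infinite {y\<in>H. A y' y}" by (rule H_degree)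
    then obtain y where y: "y \<in> H" "A y' y" "y \<notin> ran g1 \<union> Q"
      using finite_ran_emb[OF g1(1)] assms(3)
      by (metis (mono_tags, lifting) finite_UnI finite_subset mem_Collect_eq subsetI)
    then obtain g' where "partial_emb g'" "g1 \<subseteq>\<^sub>m g'" "ran g' = insert y (ran g1)" "dom g' = insert v (dom g1)"
      using add_vertex[OF g1(1) Suc(3) None, of y] H_sub y' by auto
    then show ?thesis using y g1 p(2)
      by (intro exI[of _ g']) (auto intro: map_le_trans)
  qed (use g1 p in \<open>auto intro!: exI[of _ g1]\<close>)
qed

text \<open>Stage \<open>n\<close> places the vertex \<open>e n\<close> and covers the integer
  \<open>n\<close>; the embedding is the union of the resulting chain. The invariant
  \<open>P\<close> is left open because some constructions must carry extra information from stage
  to stage.\<close>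

lemma engine:
  assumes "P g0" and emb: "\<And>g. P g \<Longrightarrow> partial_emb g"
    and vert: "\<And>g v. P g \<Longrightarrow> v \<in> V \<Longrightarrow> \<exists>g'. P g' \<and> g \<subseteq>\<^sub>m g' \<and> v \<in> dom g'"
    and cover: "\<And>g x. P g \<Longrightarrow> x \<in> X \<Longrightarrow> \<exists>g'. P g' \<and> g \<subseteq>\<^sub>m g' \<and> x \<in> ran g'"
  shows "spans V E A M X"
proof -
  obtain e :: "nat \<Rightarrow> 'a" where e: "V \<subseteq> range e"
    using countable_V by (metis empty_subsetI range_from_nat_into subset_refl)
  have "\<exists>G. \<forall>n. P (G n) \<and> (G n \<subseteq>\<^sub>m G (Suc n) \<and> (e n \<in> V \<longrightarrow> e n \<in> dom (G (Suc n)))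
          \<and> (n \<in> X \<longrightarrow> n \<in> ran (G (Suc n))))"
  proof (rule dependent_nat_choice)
    fix g n assume g: "P g"
    obtain g1 where g1: "P g1" "g \<subseteq>\<^sub>m g1" "e n \<in> V \<longrightarrow> e n \<in> dom g1"
      using g vert[of g "e n"] by (cases "e n \<in> V") auto
    obtain g2 where g2: "P g2" "g1 \<subseteq>\<^sub>m g2" "n \<in> X \<longrightarrow> n \<in> ran g2"
      using g1 cover[of g1 n] by (cases "n \<in> X") auto
    show "\<exists>g'. P g' \<and> g \<subseteq>\<^sub>m g' \<and> (e n \<in> V \<longrightarrow> e n \<in> dom g') \<and> (n \<in> X \<longrightarrow> n \<in> ran g')"
      using g1 g2 map_le_implies_dom_le[OF g2(2)] by (blast intro: map_le_trans)
  qed (use assms(1) in blast)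
  then obtain G where G: "\<And>n. P (G n)" "\<And>n. G n \<subseteq>\<^sub>m G (Suc n)"
      "\<And>n. e n \<in> V \<Longrightarrow> e n \<in> dom (G (Suc n))" "\<And>n. n \<in> X \<Longrightarrow> n \<in> ran (G (Suc n))" by blast
  have mono: "G m \<subseteq>\<^sub>m G n" if "m \<le> n" for m n
    using that by (induction n rule: dec_induct) (auto intro: map_le_trans G(2))
  have "\<exists>n y. G n v = Some y" if "v \<in> V" for v
    using that e G(3) by (metis UNIV_I domD imageE subsetD)
  then obtain f where f: "\<And>v. v \<in> V \<Longrightarrow> \<exists>n. G n v = Some (f v)" by metis
  have f_eq: "f v = y" if "G n v = Some y" for n v y
  proof -
    have "v \<in> V" using that emb[OF G(1)[of n]] by (auto simp: partial_emb_def)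
    then obtain m where "G m v = Some (f v)" using f by blast
    then have "G (max m n) v = Some (f v)" "G (max m n) v = Some y"
      using that mono[of m "max m n"] mono[of n "max m n"] by (auto simp: map_le_def dom_def)
    then show ?thesis by simp
  qed
  have both: "\<exists>n. G n u = Some (f u) \<and> G n v = Some (f v)" if "u \<in> V" "v \<in> V" for u v
  proof -
    obtain m n where "G m u = Some (f u)" "G n v = Some (f v)" using f[OF \<open>u \<in> V\<close>] f[OF \<open>v \<in> V\<close>] by blast
    then have "G (max m n) u = Some (f u)" "G (max m n) v = Some (f v)"
      using mono[of m "max m n"] mono[of n "max m n"] by (auto simp: map_le_def dom_def)
    then show ?thesis by blast
  qed
  have "inj_on f V"
  proof (rule inj_onI)
    fix u v assume uv: "u \<in> V" "v \<in> V" "f u = f v"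
    then obtain n where "G n u = Some (f u)" "G n v = Some (f v)" using both by blast
    then show "u = v" using uv(3) emb[OF G(1)[of n]] by (metis domI inj_onD partial_emb_def)
  qed
  moreover have "f ` V \<subseteq> M"
  proof
    fix y assume "y \<in> f ` V"
    then obtain v n where "G n v = Some y" using f by blast
    then show "y \<in> M" using emb[OF G(1)[of n]] by (auto simp: partial_emb_def ran_def)
  qed
  moreover have "A (f u) (f v)" if "E u v" for u v
  proof -
    have kid: "A (f u) (f v)" if uv: "u \<in> kids v" for u v
    proof -
      obtain n where "G n u = Some (f u)" "G n v = Some (f v)" using both kids_in[OF uv] by blast
      then show ?thesis
        using emb[OF G(1)[of n]] uv unfolding partial_emb_def kids_def by blast
    qed
    show ?thesis using edge_cases[OF that] kid sym_A by blast
  qed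
  moreover have "X \<subseteq> f ` V"
  proof
    fix x assume "x \<in> X"
    then obtain v where v: "G (Suc x) v = Some x" using G(4) by (auto simp: ran_def)
    moreover have "v \<in> V" using v emb[OF G(1)[of "Suc x"]] by (auto simp: partial_emb_def)
    ultimately show "x \<in> f ` V" using f_eq by blast
  qed
  ultimately show ?thesis unfolding spans_def by blast
qed

lemma engine_base:
  assumes "partial_emb g0"
    and cover: "\<And>g x. partial_emb g \<Longrightarrow> g0 \<subseteq>\<^sub>m g \<Longrightarrow> x \<in> X \<Longrightarrow> x \<notin> ran g \<Longrightarrow>
                  \<exists>g'. partial_emb g' \<and> g \<subseteq>\<^sub>m g' \<and> x \<in> ran g'"
  shows "spans V E A M X"
proof (rule engine[where P = "\<lambda>g. partial_emb g \<and> g0 \<subseteq>\<^sub>m g" and ?g0.0 = g0])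
  fix g v assume "partial_emb g \<and> g0 \<subseteq>\<^sub>m g" "v \<in> V"
  then show "\<exists>g'. (partial_emb g' \<and> g0 \<subseteq>\<^sub>m g') \<and> g \<subseteq>\<^sub>m g' \<and> v \<in> dom g'"
    using extend_vertex[of g v "{}"] by (blast intro: map_le_trans)
next
  fix g x assume "partial_emb g \<and> g0 \<subseteq>\<^sub>m g" "x \<in> X"
  then show "\<exists>g'. (partial_emb g' \<and> g0 \<subseteq>\<^sub>m g') \<and> g \<subseteq>\<^sub>m g' \<and> x \<in> ran g'"
    using cover[of g x] by (cases "x \<in> ran g") (auto intro: map_le_trans)
qed (use assms(1) in auto)

lemma add_leaf_kids:
  assumes "partial_emb g" "g p = Some z" "finite L" "L \<subseteq> leaf_kids p" "L \<inter> dom g = {}"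
    and "finite S" "card S \<le> card L" "S \<subseteq> M" "S \<inter> ran g = {}" "\<And>y. y \<in> S \<Longrightarrow> A z y"
  shows "\<exists>g'. partial_emb g' \<and> g \<subseteq>\<^sub>m g' \<and> ran g' = ran g \<union> S"
  using assms(6,1-5,7-)
proof (induction S arbitrary: g L rule: finite_induct)
  case empty
  then show ?case by auto
next
  case (insert y S)
  have "L \<noteq> {}" using insert.hyps insert.prems(6) by auto
  then obtain u where u: "u \<in> L" by blast
  then have uk: "u \<in> kids p" "kids u = {}" "g u = None"
    using insert.prems(4,5) by (auto simp: leaf_kids_def domIff)
  obtain g1 where g1: "partial_emb g1" "g \<subseteq>\<^sub>m g1" "ran g1 = insert y (ran g)" "dom g1 = insert u (dom g)"
    using add_vertex[OF insert.prems(1), of u y] uk insert.prems(2,7,8,9) kids_in[OF uk(1)] by auto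
  have "\<exists>g'. partial_emb g' \<and> g1 \<subseteq>\<^sub>m g' \<and> ran g' = ran g1 \<union> S"
  proof (rule insert.IH)
    show "g1 p = Some z" using insert.prems(2) g1(2) by (auto simp: map_le_def dom_def)
    show "card S \<le> card (L - {u})" using insert.prems(3,6) insert.hyps u by simp
  qed (use g1 insert u in auto)
  then show ?case using g1 by (auto intro: map_le_trans)
qed

text \<open>One hub \<open>z\<close> outside the range is kept in reserve, such that almost all elements of \<open>Y\<close> not
  joined to \<open>z\<close> are covered already. To cover a further element, fix the next reserve hub \<open>z'\<close>,
  place at \<open>z\<close> a vertex with many leaf children, and cover with these all elements of \<open>Y\<close>
  not joined to \<open>z'\<close>.\<close>

lemma leaf_trick:
  assumes g0: "partial_emb g0" and Z: "infinite Z" and Y: "Y \<subseteq> M"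
    and fin: "\<And>z. z \<in> Z \<Longrightarrow> finite {y\<in>Y. \<not> A z y}"
    and hub: "\<And>g z n Q. partial_emb g \<Longrightarrow> g0 \<subseteq>\<^sub>m g \<Longrightarrow> z \<in> Z \<Longrightarrow> z \<notin> ran g \<Longrightarrow> finite Q \<Longrightarrow> z \<notin> Q \<Longrightarrow>
        \<exists>g' p L. partial_emb g' \<and> g \<subseteq>\<^sub>m g' \<and> g' p = Some z \<and> ran g' \<inter> Q \<subseteq> ran g \<and>
          L \<subseteq> leaf_kids p \<and> L \<inter> dom g' = {} \<and> finite L \<and> card L = n"
    and near: "\<And>g x Q. partial_emb g \<Longrightarrow> g0 \<subseteq>\<^sub>m g \<Longrightarrow> x \<in> X - Y \<Longrightarrow> x \<notin> ran g \<Longrightarrow> finite Q \<Longrightarrow> x \<notin> Q \<Longrightarrow>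
        \<exists>g'. partial_emb g' \<and> g \<subseteq>\<^sub>m g' \<and> x \<in> ran g' \<and> ran g' \<inter> Q \<subseteq> ran g"
  shows "\<exists>X0. finite X0 \<and> spans V E A M (X - X0)"
proof -
  have ex_hub: "\<exists>z. z \<in> Z \<and> z \<notin> Q" if "finite Q" for Q
    using Z that by (meson finite_subset subsetI)
  obtain z1 where z1: "z1 \<in> Z" "z1 \<notin> ran g0" using ex_hub[OF finite_ran_emb[OF g0]] by blast
  \<comment> \<open>No earlier hub takes care of the exceptions of the first reserve hub, so these
    finitely many integers are removed from the target set.\<close>
  define X0 where "X0 = {y\<in>Y. \<not> A z1 y}"
  define R where "R z g \<longleftrightarrow> z \<in> Z \<and> z \<notin> ran g \<and> {y\<in>Y. \<not> A z y \<and> y \<noteq> z} - X0 \<subseteq> ran g"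
    for z and g :: "'a \<Rightarrow> nat option"
  define P where "P g \<longleftrightarrow> partial_emb g \<and> g0 \<subseteq>\<^sub>m g \<and> (\<exists>z. R z g)" for g
  have P_mono: "P g'" if "partial_emb g'" "P g" "g \<subseteq>\<^sub>m g'" "R z g" "z \<notin> ran g'" for g g' z
  proof -
    have "ran g \<subseteq> ran g'" using that(3) by (force simp: map_le_def ran_def dom_def)
    then show ?thesis using that unfolding P_def R_def by (blast intro: map_le_trans)
  qed
  have macro: "\<exists>g'. P g' \<and> g \<subseteq>\<^sub>m g' \<and> x \<in> ran g'"
    if P: "P g" and R: "R z g" and x: "x \<in> Y - X0 \<or> x = z" "x \<notin> ran g" for g z x
  proof -
    have g: "partial_emb g" "g0 \<subseteq>\<^sub>m g" using P by (auto simp: P_def)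
    obtain z' where z': "z' \<in> Z" "z' \<notin> ran g \<union> {z, x}"
      using ex_hub[of "ran g \<union> {z, x}"] finite_ran_emb[OF g(1)] by auto
    \<comment> \<open>The leaves at \<open>z\<close> have to take the new integer and the exceptions
      of the next reserve hub \<open>z'\<close>. By the invariant, the exceptions of
      \<open>z\<close> itself are already covered or lie in \<open>X0\<close>, so \<open>z\<close>
      is joined to all of \<open>S\<close>.\<close>
    define S where "S = (insert x {y\<in>Y. \<not> A z' y \<and> y \<noteq> z'} - X0 - ran g) - {z}"
    have "{y\<in>Y. \<not> A z' y \<and> y \<noteq> z'} \<subseteq> {y\<in>Y. \<not> A z' y}" by auto
    then have finS: "finite S" unfolding S_def using fin[OF z'(1)] by (meson finite_Diff finite_insert finite_subset)
    have S_A: "A z y" if "y \<in> S" for y using that R x unfolding S_def R_def by blast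
    have "finite (insert z' S)" "z \<notin> insert z' S" using finS z' by (auto simp: S_def)
    then obtain g1 p L where g1: "partial_emb g1" "g \<subseteq>\<^sub>m g1" "g1 p = Some z" "ran g1 \<inter> insert z' S \<subseteq> ran g"
        "L \<subseteq> leaf_kids p" "L \<inter> dom g1 = {}" "finite L" "card L = card S"
      using hub[OF g(1,2), of z "insert z' S" "card S"] R unfolding R_def by blast
    have "S \<inter> ran g1 = {}" using g1(4) by (auto simp: S_def)
    moreover have "S \<subseteq> M" using Y x by (auto simp: S_def)
    ultimately obtain g2 where g2: "partial_emb g2" "g1 \<subseteq>\<^sub>m g2" "ran g2 = ran g1 \<union> S"
      using add_leaf_kids[OF g1(1,3,7,5,6) finS, of] g1(8) S_A by auto
    have le: "g \<subseteq>\<^sub>m g2" using g1(2) g2(2) by (rule map_le_trans)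
    then have sub: "ran g \<subseteq> ran g2" by (force simp: map_le_def ran_def dom_def)
    have zin: "z \<in> ran g2" using g1(3) g2(3) by (auto simp: ran_def)
    have "z' \<notin> ran g2" using g1(4) g2(3) z' by (auto simp: S_def)
    moreover have "{y\<in>Y. \<not> A z' y \<and> y \<noteq> z'} - X0 \<subseteq> ran g2"
      using sub g2(3) zin unfolding S_def by blast
    ultimately have "R z' g2" using z' unfolding R_def by blast
    then have "P g2" using g2(1) g(2) le unfolding P_def by (blast intro: map_le_trans)
    moreover have "x \<in> ran g2" using g2(3) x zin sub unfolding S_def X0_def by auto
    ultimately show ?thesis using le by blast
  qed
  have "spans V E A M (X - X0)"
  proof (rule engine[where P = P and ?g0.0 = g0])
    have "R z1 g0" unfolding R_def X0_def using z1 by auto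
    then show "P g0" using g0 unfolding P_def by auto
  next
    fix g v assume P: "P g" and v: "v \<in> V"
    obtain z where z: "R z g" "partial_emb g" using P by (auto simp: P_def)
    obtain g' where g': "partial_emb g'" "g \<subseteq>\<^sub>m g'" "v \<in> dom g'" "ran g' \<inter> {z} \<subseteq> ran g"
      using extend_vertex[OF z(2) v, of "{z}"] by auto
    moreover have "z \<notin> ran g'" using z g'(4) by (auto simp: R_def)
    ultimately show "\<exists>g'. P g' \<and> g \<subseteq>\<^sub>m g' \<and> v \<in> dom g'" using P_mono[OF g'(1) P g'(2) z(1)] by blast
  next
    fix g x assume P: "P g" and x: "x \<in> X - X0"
    obtain z where z: "R z g" "partial_emb g" "g0 \<subseteq>\<^sub>m g" using P by (auto simp: P_def)
    consider "x \<in> ran g" | "x \<notin> ran g" "x \<in> Y \<or> x = z" | "x \<notin> ran g" "x \<notin> Y" "x \<noteq> z" by blast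
    then show "\<exists>g'. P g' \<and> g \<subseteq>\<^sub>m g' \<and> x \<in> ran g'"
    proof cases
      case 1
      then show ?thesis using P by auto
    next
      case 2
      then show ?thesis using macro[OF P z(1)] x by blast
    next
      case 3
      then obtain g' where g': "partial_emb g'" "g \<subseteq>\<^sub>m g'" "x \<in> ran g'" "ran g' \<inter> {z} \<subseteq> ran g"
        using near[OF z(2,3), of x "{z}"] x by auto
      moreover have "z \<notin> ran g'" using z g'(4) by (auto simp: R_def)
      ultimately show ?thesis using P_mono[OF g'(1) P g'(2) z(1)] by blast
    qed
  qed (auto simp: P_def)
  moreover have "finite X0" unfolding X0_def using fin z1 by blast
  ultimately show ?thesis by blast
qed

section \<open>Covering a single integer by a short path\<close>

lemma map_le_Some: "g \<subseteq>\<^sub>m g' \<Longrightarrow> g v = Some y \<Longrightarrow> g' v = Some y"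
  by (force simp: map_le_def dom_def)

lemma fresh_vertex:
  assumes "partial_emb g" "infinite U"
  obtains u where "u \<in> U" "g u = None"
proof -
  have "\<not> U \<subseteq> dom g" using assms finite_subset unfolding partial_emb_def by blast
  then show thesis using that by (auto simp: domIff)
qed

lemma fresh_nat:
  assumes "partial_emb g" "infinite (Z :: nat set)" "finite Q"
  obtains z where "z \<in> Z" "z \<notin> ran g" "z \<notin> Q"
proof -
  have "infinite (Z - (ran g \<union> Q))" using assms finite_ran_emb by simp
  then show thesis using that infinite_imp_nonempty by blast
qed

lemma add_child:
  assumes "partial_emb g" "g s = Some v" "u \<in> kids s" "g u = None" "y \<in> M" "y \<notin> ran g" "A v y"
    "y \<in> H \<or> kids u = {}"
  shows "\<exists>g'. partial_emb g' \<and> g \<subseteq>\<^sub>m g' \<and> ran g' = insert y (ran g) \<and>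
           dom g' = insert u (dom g) \<and> g' u = Some y"
  using add_vertex[OF assms(1), of u y] kids_in[OF assms(3)] assms by auto

lemma cover_child:
  assumes "partial_emb g" "g s = Some v" "infinite (kids s)" "x \<in> H" "x \<notin> ran g" "A v x"
  shows "\<exists>g'. partial_emb g' \<and> g \<subseteq>\<^sub>m g' \<and> ran g' = insert x (ran g)"
proof -
  obtain u where "u \<in> kids s" "g u = None" using fresh_vertex[OF assms(1,3)] .
  then show ?thesis using add_child[OF assms(1,2), of u x] assms H_sub by blast
qed

lemma cover_leaf_kid:
  assumes "partial_emb g" "g s = Some v" "infinite (leaf_kids s)" "x \<in> M" "x \<notin> ran g" "A v x"
  shows "\<exists>g'. partial_emb g' \<and> g \<subseteq>\<^sub>m g' \<and> ran g' = insert x (ran g)"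
proof -
  obtain u where "u \<in> leaf_kids s" "g u = None" using fresh_vertex[OF assms(1,3)] .
  then have u: "u \<in> kids s" "kids u = {}" "g u = None" by (auto simp: leaf_kids_def)
  show ?thesis using add_child[OF assms(1,2) u(1,3)] assms u(2) by blast
qed

lemma cover_grandchild:
  assumes g: "partial_emb g" "g s = Some v" and kids: "infinite {u\<in>kids s. kids u \<noteq> {}}"
    and x: "x \<in> H" "x \<notin> ran g" and Q: "finite Q" "x \<notin> Q" and z: "infinite {z\<in>H. A v z \<and> A z x}"
  shows "\<exists>g'. partial_emb g' \<and> g \<subseteq>\<^sub>m g' \<and> x \<in> ran g' \<and> ran g' \<inter> Q \<subseteq> ran g"
proof -
  obtain u where u: "u \<in> kids s" "kids u \<noteq> {}" "g u = None" using fresh_vertex[OF g(1) kids] by blast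
  then obtain w where w: "w \<in> kids u" by blast
  obtain z where z: "z \<in> H" "A v z" "A z x" "z \<notin> ran g" "z \<noteq> x" "z \<notin> Q"
    using fresh_nat[OF g(1) z, of "insert x Q"] Q by auto
  obtain g1 where g1: "partial_emb g1" "g \<subseteq>\<^sub>m g1" "ran g1 = insert z (ran g)" "dom g1 = insert u (dom g)" "g1 u = Some z"
    using add_child[OF g u(1,3)] z H_sub by blast
  have "u \<noteq> w" using kids_in[OF w] by auto
  then have "g1 w = None" using kids_fresh[OF g(1) u(3) w] g1(4) by (metis domIff insertE)
  then obtain g2 where g2: "partial_emb g2" "g1 \<subseteq>\<^sub>m g2" "ran g2 = insert x (ran g1)"
    using add_child[OF g1(1,5) w, of x] z(3,5) x H_sub g1(3) by auto
  moreover have "ran g2 \<inter> Q \<subseteq> ran g" using g2(3) g1(3) z(6) Q(2) by auto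
  ultimately show ?thesis using map_le_trans[OF g1(2) g2(2)] by auto
qed

lemma cover_great_grandchild:
  assumes g: "partial_emb g" "g s = Some v" and kids: "infinite {u\<in>kids s. \<exists>w\<in>kids u. kids w \<noteq> {}}"
    and x: "x \<in> H" "x \<notin> ran g"
    and path: "\<And>Q. finite Q \<Longrightarrow> \<exists>z n. z \<in> H \<and> n \<in> H \<and> z \<noteq> n \<and> z \<notin> Q \<and> n \<notin> Q \<and> A v z \<and> A z n \<and> A n x"
  shows "\<exists>g'. partial_emb g' \<and> g \<subseteq>\<^sub>m g' \<and> x \<in> ran g'"
proof -
  obtain u where "u \<in> {u\<in>kids s. \<exists>w\<in>kids u. kids w \<noteq> {}}" "g u = None"
    using fresh_vertex[OF g(1) kids] .
  then have u: "u \<in> kids s" "g u = None" and "\<exists>w\<in>kids u. kids w \<noteq> {}" by simp_all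
  then obtain w t where w: "w \<in> kids u" "t \<in> kids w" by (metis all_not_in_conv)
  have "\<delta> w = Suc (\<delta> u)" "\<delta> t = Suc (\<delta> w)" using kids_in[OF w(1)] kids_in[OF w(2)] by blast+
  then have dist: "u \<noteq> w" "t \<noteq> u" "t \<noteq> w" by auto
  obtain z n where z: "z \<in> H" "n \<in> H" "z \<noteq> n" "z \<notin> insert x (ran g)" "n \<notin> insert x (ran g)" "A v z" "A z n" "A n x"
    using path[of "insert x (ran g)"] finite_ran_emb[OF g(1)] by auto
  obtain g1 where g1: "partial_emb g1" "g \<subseteq>\<^sub>m g1" "ran g1 = insert z (ran g)" "dom g1 = insert u (dom g)" "g1 u = Some z"
    using add_child[OF g u(1,2)] z H_sub by blast
  have gw: "g w = None" using kids_fresh[OF g(1) u(2) w(1)] .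
  then have "g1 w = None" using g1(4) dist by (metis domIff insertE)
  then obtain g2 where g2: "partial_emb g2" "g1 \<subseteq>\<^sub>m g2" "ran g2 = insert n (ran g1)" "dom g2 = insert w (dom g1)" "g2 w = Some n"
    using add_child[OF g1(1,5) w(1), of n] z(2,3,5,7) H_sub g1(3) by auto
  have "g t = None" using kids_fresh[OF g(1) gw w(2)] .
  then have "g2 t = None" using g2(4) g1(4) dist by (metis domIff insertE)
  then obtain g3 where g3: "partial_emb g3" "g2 \<subseteq>\<^sub>m g3" "ran g3 = insert x (ran g2)"
    using add_child[OF g2(1,5) w(2), of x] z(4,5,8) x H_sub g1(3) g2(3) by auto
  then show ?thesis using map_le_trans[OF map_le_trans[OF g1(2) g2(2)] g3(2)] by auto
qed

section \<open>Laying out whole paths of the forest\<close>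

lemma place_root:
  assumes "s \<in> V" "\<delta> s = 0" "y \<in> H"
  shows "\<exists>g. partial_emb g \<and> g s = Some y"
  using add_vertex[OF partial_emb_empty assms(1), of y] assms H_sub by auto

text \<open>The list \<open>ys\<close> receives the ancestors of \<open>w\<close> in order from the
  root down to \<open>w\<close>. This starts a partial embedding with prescribed images for both
  ends, while all vertices off this path stay free.\<close>

lemma place_path:
  assumes "w \<in> V" "length ys = Suc (\<delta> w)" "distinct ys" "set ys \<subseteq> H" "successively A ys"
  shows "\<exists>g. partial_emb g \<and> g w = Some (last ys) \<and> g ((\<pi> ^^ \<delta> w) w) = Some (hd ys) \<and> ran g = set ys
           \<and> (\<forall>u\<in>dom g. \<exists>k\<le>\<delta> w. u = (\<pi> ^^ k) w)"
  using assms
proof (induction "\<delta> w" arbitrary: w ys)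
  case 0
  then obtain y where y: "ys = [y]" by (cases ys) auto
  moreover obtain g where "partial_emb g" "ran g = {y}" "dom g = {w}" "g w = Some y"
    using add_vertex[OF partial_emb_empty 0(2), of y] 0(1,5) y H_sub by auto
  ultimately show ?case using 0(1) by (intro exI[of _ g]) auto
next
  case (Suc n)
  then obtain zs y where ys: "ys = zs @ [y]" "zs \<noteq> []" 
    using Suc(2) Suc.prems(2) by (metis length_0_conv length_append_singleton nat.simps(3) nat.inject rev_exhaust)
  have p: "\<pi> w \<in> V" "\<delta> w = Suc (\<delta> (\<pi> w))" using parent[of w] Suc(2) Suc.prems(1) by auto
  obtain g where g: "partial_emb g" "g (\<pi> w) = Some (last zs)" "g ((\<pi> ^^ n) (\<pi> w)) = Some (hd zs)" "ran g = set zs"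
     "\<forall>u\<in>dom g. \<exists>k\<le>n. u = (\<pi> ^^ k) (\<pi> w)"
    using Suc(1)[of "\<pi> w" zs] Suc(2) Suc.prems p ys by (auto simp: successively_append_iff)
  have "g w = None"
  proof (rule ccontr)
    assume "g w \<noteq> None"
    then obtain k where "k \<le> n" "w = (\<pi> ^^ k) (\<pi> w)" using g(5) by (metis domIff)
    then show False using ancestor[of "\<pi> w" k] p Suc(2) by auto
  qed
  moreover have "A (last zs) y" "y \<in> H" "y \<in> M" using Suc.prems(4,5) ys H_sub by (auto simp: successively_append_iff)
  ultimately obtain g' where g': "partial_emb g'" "g \<subseteq>\<^sub>m g'" "ran g' = insert y (ran g)" "dom g' = insert w (dom g)" "g' w = Some y"
    using add_vertex[OF g(1) Suc(3), of y] g ys Suc.prems H_sub by auto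
  have "(\<pi> ^^ \<delta> w) w = (\<pi> ^^ n) (\<pi> w)" using Suc(2) by (metis funpow_Suc_right o_apply)
  moreover have "\<exists>k\<le>\<delta> w. u = (\<pi> ^^ k) w" if u: "u \<in> dom g'" for u
  proof (cases "u = w")
    case True
    then show ?thesis by (intro exI[of _ 0]) simp
  next
    case False
    then obtain k where "k \<le> n" "u = (\<pi> ^^ k) (\<pi> w)" using u g(5) g'(4) by blast
    then show ?thesis using Suc(2) by (intro exI[of _ "Suc k"]) (auto simp: funpow_Suc_right simp del: funpow.simps)
  qed
  ultimately show ?case
    using g g' ys map_le_Some[OF g'(2) g(3)] by (intro exI[of _ g']) auto
qed

text \<open>Built backwards from \<open>y\<close>: the current first element has infinitely many
  neighbours in \<open>H\<close>, so a new one can be put in front.\<close>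

lemma path_to:
  assumes "y \<in> H" "finite Q"
  shows "\<exists>ys. length ys = Suc n \<and> distinct ys \<and> set ys \<subseteq> H \<and> successively A ys \<and> last ys = y \<and> set ys \<inter> Q \<subseteq> {y}"
proof (induction n)
  case 0
  show ?case using assms by (intro exI[of _ "[y]"]) auto
next
  case (Suc n)
  then obtain ys where ys: "length ys = Suc n" "distinct ys" "set ys \<subseteq> H" "successively A ys" "last ys = y" "set ys \<inter> Q \<subseteq> {y}"
    by blast
  have "hd ys \<in> H" using ys by (cases ys) auto
  then have "infinite ({z\<in>H. A (hd ys) z} - (set ys \<union> Q))" using H_degree assms by simp
  then obtain z where "z \<in> H" "A (hd ys) z" "z \<notin> set ys" "z \<notin> Q"
    using infinite_imp_nonempty by blast
  then show ?case
    using ys sym_A by (intro exI[of _ "z # ys"]) (auto simp: successively_Cons)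
qed

text \<open>The placed vertex \<open>u\<close> is the ancestor of \<open>w\<close> at distance
  \<open>k\<close>, and every vertex below it down to \<open>w\<close> is free. The path
  \<open>ys\<close> is laid downwards along this stretch, which is long enough because
  \<open>length ys\<close> is at most \<open>k\<close>.\<close>

lemma cover_path:
  assumes "partial_emb g" "g u = Some y" "successively A (y # ys)" "distinct ys" "set ys \<inter> ran g = {}"
    "set ys \<subseteq> H" "w \<in> V" "length ys \<le> k" "k \<le> \<delta> w" "(\<pi> ^^ k) w = u" "\<And>i. i < k \<Longrightarrow> g ((\<pi> ^^ i) w) = None"
  shows "\<exists>g'. partial_emb g' \<and> g \<subseteq>\<^sub>m g' \<and> set ys \<subseteq> ran g'"
  using assms
proof (induction ys arbitrary: g u y k)
  case Nil
  then show ?case by auto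
next
  case (Cons z zs)
  then obtain k' where k: "k = Suc k'" by (cases k) auto
  let ?w = "(\<pi> ^^ k') w"
  have w: "?w \<in> V" "\<delta> ?w = \<delta> w - k'" "\<pi> ?w = u" "g ?w = None" "\<delta> ?w \<noteq> 0"
    using ancestor[of w k'] Cons.prems k by auto
  obtain g1 where g1: "partial_emb g1" "g \<subseteq>\<^sub>m g1" "ran g1 = insert z (ran g)" "dom g1 = insert ?w (dom g)" "g1 ?w = Some z"
    using add_vertex[OF Cons.prems(1) w(1,4), of z] Cons.prems w H_sub by auto
  have "\<exists>g'. partial_emb g' \<and> g1 \<subseteq>\<^sub>m g' \<and> set zs \<subseteq> ran g'"
  proof (rule Cons.IH[OF g1(1,5)])
    show "g1 ((\<pi> ^^ i) w) = None" if "i < k'" for i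
    proof -
      have "(\<pi> ^^ i) w \<noteq> ?w" using ancestor[of w i] w(2) Cons.prems(7,9) k that by auto
      then show ?thesis using g1(4) Cons.prems(11)[of i] that k by (metis domIff insertE less_SucI)
    qed
  qed (use Cons.prems k g1(3) in auto)
  then obtain g' where g': "partial_emb g'" "g1 \<subseteq>\<^sub>m g'" "set zs \<subseteq> ran g'" by blast
  moreover have "z \<in> ran g'" using map_le_Some[OF g'(2) g1(5)] by (auto simp: ran_def)
  ultimately show ?case using g1(2) by (auto intro: map_le_trans)
qed

end

text \<open>Defined from the graph alone, so that it survives a change of rooting; in any rooting it
  differs from \<open>leaf_kids p\<close> at most by the parent of \<open>p\<close>.\<close>

definition leaf_nbrs :: "('a \<Rightarrow> 'a \<Rightarrow> bool) \<Rightarrow> 'a \<Rightarrow> 'a set" where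
  "leaf_nbrs E p = {u. E p u \<and> is_leaf E u}"

context rooted_forest
begin

lemma leaf_kids_leaf: "leaf_kids p \<subseteq> leaf_nbrs E p"
proof
  fix u assume "u \<in> leaf_kids p"
  then have u: "u \<in> kids p" "kids u = {}" by (auto simp: leaf_kids_def)
  then have "nbhd E u = {p}" using kids_in[OF u(1)] nbhd_nonroot[of u] by auto
  then show "u \<in> leaf_nbrs E p" using kids_edge[OF u(1)] by (simp add: leaf_nbrs_def is_leaf_def)
qed

lemma leaf_nbr_cases:
  assumes "u \<in> leaf_nbrs E p"
  shows "u \<in> leaf_kids p \<or> p \<in> kids u"
proof -
  have u: "E p u" "card (nbhd E u) = 1" using assms by (auto simp: leaf_nbrs_def is_leaf_def)
  then have "p \<in> nbhd E u" using graph by (auto simp: nbhd_def simple_graph_def)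
  then have nb: "nbhd E u = {p}" using u(2) by (metis card_1_singletonE singletonD)
  show ?thesis
  proof (cases "u \<in> kids p")
    case True
    have "w = p" if "w \<in> kids u" for w using kids_edge[OF that] nb by (simp add: nbhd_def set_eq_iff)
    moreover have "p \<notin> kids u" using kids_in[of p u] kids_in[OF True] by force
    ultimately have "kids u = {}" by blast
    then show ?thesis using True by (simp add: leaf_kids_def)
  next
    case False
    then show ?thesis using edge_cases[OF u(1)] by blast
  qed
qed

lemma leaf_nbrs_subset: "leaf_nbrs E p \<subseteq> insert (\<pi> p) (leaf_kids p)"
  using leaf_nbr_cases by (auto simp: kids_def)

end

section \<open>Copies built on isolated vertices and on large stars\<close>

context hosted_forest
begin

lemma spans_isolated:
  assumes "infinite {v\<in>V. nbhd E v = {}}"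
  shows "spans V E A M M"
proof (rule engine_base[OF partial_emb_empty])
  fix g x assume g: "partial_emb g" and x: "x \<in> M" "x \<notin> ran g"
  obtain v where "v \<in> {v\<in>V. nbhd E v = {}}" "g v = None" using fresh_vertex[OF g assms] .
  then have v: "v \<in> V" "nbhd E v = {}" "g v = None" by auto
  then have "kids v = {}" using kids_edge by (auto simp: nbhd_def)
  moreover have "\<delta> v = 0" using parent(3)[OF v(1)] v(2) by (auto simp: nbhd_def)
  ultimately show "\<exists>g'. partial_emb g' \<and> g \<subseteq>\<^sub>m g' \<and> x \<in> ran g'"
    using add_vertex[OF g v(1,3) x] by auto
qed

lemma spans_infinite_star:
  assumes "t \<in> V" "\<delta> t = 0" "infinite (leaf_kids t)" "h \<in> H"
  shows "spans V E A M {x\<in>M. A h x}"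
proof -
  obtain g0 where g0: "partial_emb g0" "g0 t = Some h" using place_root assms by blast
  show ?thesis
  proof (rule engine_base[OF g0(1)])
    fix g x assume g: "partial_emb g" "g0 \<subseteq>\<^sub>m g" "x \<in> {x\<in>M. A h x}" "x \<notin> ran g"
    then have "\<exists>g'. partial_emb g' \<and> g \<subseteq>\<^sub>m g' \<and> ran g' = insert x (ran g)"
      using cover_leaf_kid[OF g(1) map_le_Some[OF g(2) g0(2)] assms(3), of x] by auto
    then show "\<exists>g'. partial_emb g' \<and> g \<subseteq>\<^sub>m g' \<and> x \<in> ran g'" by auto
  qed
qed

text \<open>This is \<open>leaf_trick\<close> with \<open>Y = M\<close> and \<open>Z = H\<close>.
  The clique makes every hub usable: wherever in \<open>H\<close> the parent of the star vertex
  sits, it is joined to \<open>z\<close>.\<close>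

lemma spans_unbounded_stars:
  assumes clique: "\<And>x y. x \<in> H \<Longrightarrow> y \<in> H \<Longrightarrow> x \<noteq> y \<Longrightarrow> A x y"
    and fin: "\<And>h. h \<in> H \<Longrightarrow> finite {y\<in>M. \<not> A h y}"
    and stars: "\<And>n F. finite F \<Longrightarrow> \<exists>p\<in>V - F. \<exists>L\<subseteq>leaf_kids p. finite L \<and> card L = n"
  shows "\<exists>X0. finite X0 \<and> spans V E A M (M - X0)"
proof (rule leaf_trick[OF partial_emb_empty H_infinite order_refl fin])
  fix g :: "'a \<Rightarrow> nat option" and z n and Q :: "nat set"
  assume g: "partial_emb g" and z: "z \<in> H" "z \<notin> ran g" and Q: "finite Q" "z \<notin> Q"
  have "finite (dom g)" using g by (simp add: partial_emb_def)
  then obtain p L where p: "p \<in> V" "g p = None" and L: "L \<subseteq> leaf_kids p" "finite L" "card L = n"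
    using stars[of "dom g" n] by auto
  \<comment> \<open>The parent of \<open>p\<close> is placed first, away from \<open>z\<close> and
    \<open>Q\<close>. Only vertices less deep than \<open>p\<close> are added, so \<open>p\<close>
    stays free for \<open>z\<close>.\<close>
  have "\<exists>g1. partial_emb g1 \<and> g \<subseteq>\<^sub>m g1 \<and> g1 p = None \<and> z \<notin> ran g1 \<and> ran g1 \<inter> Q \<subseteq> ran g \<and>
          (\<delta> p \<noteq> 0 \<longrightarrow> (\<exists>y'. g1 (\<pi> p) = Some y' \<and> A y' z))"
  proof (cases "\<delta> p = 0")
    case False
    obtain g1 where g1: "partial_emb g1" "g \<subseteq>\<^sub>m g1" "\<pi> p \<in> dom g1" "ran g1 \<inter> insert z Q \<subseteq> ran g"
        "\<forall>w\<in>dom g1. w \<in> dom g \<or> \<delta> w \<le> \<delta> (\<pi> p)"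
      using extend_vertex[OF g parent(1)[OF p(1) False], of "insert z Q"] Q by auto
    have zn: "z \<notin> ran g1" using g1(4) z by auto
    obtain y' where y': "g1 (\<pi> p) = Some y'" using g1(3) by auto
    have "p \<in> kids (\<pi> p)" using p False by (simp add: kids_def)
    then have "y' \<in> H" using g1(1) y' unfolding partial_emb_def by blast
    moreover have "y' \<noteq> z" using zn y' by (auto simp: ran_def)
    ultimately have "A y' z" using clique z by blast
    moreover have "g1 p = None" using g1(5) p parent(2)[OF p(1) False] by (metis domIff not_less_eq_eq order_refl)
    ultimately show ?thesis using g1 zn y' by (intro exI[of _ g1]) auto
  qed (use g p z in auto)
  then obtain g1 where g1: "partial_emb g1" "g \<subseteq>\<^sub>m g1" "g1 p = None" "z \<notin> ran g1" "ran g1 \<inter> Q \<subseteq> ran g"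
          "\<delta> p \<noteq> 0 \<longrightarrow> (\<exists>y'. g1 (\<pi> p) = Some y' \<and> A y' z)" by blast
  obtain g2 where g2: "partial_emb g2" "g1 \<subseteq>\<^sub>m g2" "ran g2 = insert z (ran g1)" "dom g2 = insert p (dom g1)" "g2 p = Some z"
    using add_vertex[OF g1(1) p(1) g1(3), of z] z H_sub g1 by auto
  have "L \<inter> dom g2 = {}"
  proof -
    have "g1 u = None \<and> u \<noteq> p" if "u \<in> L" for u
      using that L(1) kids_fresh[OF g1(1,3)] kids_in[of u p] by (auto simp: leaf_kids_def)
    then show ?thesis using g2(4) by auto
  qed
  then show "\<exists>g' p L. partial_emb g' \<and> g \<subseteq>\<^sub>m g' \<and> g' p = Some z \<and> ran g' \<inter> Q \<subseteq> ran g \<and>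
          L \<subseteq> leaf_kids p \<and> L \<inter> dom g' = {} \<and> finite L \<and> card L = n"
    using g2 g1 L Q by (intro exI[of _ g2] exI[of _ p] exI[of _ L]) (auto intro: map_le_trans)
qed auto

end

section \<open>Colourings with infinite degrees\<close>

text \<open>The inequality discards the value of \<open>c\<close> on singletons.\<close>

definition adj :: "(nat set \<Rightarrow> bool) \<Rightarrow> bool \<Rightarrow> nat \<Rightarrow> nat \<Rightarrow> bool" where
  "adj c b x y \<longleftrightarrow> x \<noteq> y \<and> c {x, y} = b"

lemma adj_sym: "adj c b x y \<Longrightarrow> adj c b y x"
  by (auto simp: adj_def insert_commute)

lemma adj_cases: "x \<noteq> y \<Longrightarrow> adj c b x y \<or> adj c (\<not> b) x y"
  by (auto simp: adj_def)

locale coloured_forest = rooted_forest V E \<pi> \<delta>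
  for V :: "'a set" and E :: "'a \<Rightarrow> 'a \<Rightarrow> bool" and \<pi> :: "'a \<Rightarrow> 'a" and \<delta> :: "'a \<Rightarrow> nat" +
  fixes c :: "nat set \<Rightarrow> bool" and M :: "nat set"
  assumes M_ne: "M \<noteq> {}"
    and degree: "x \<in> M \<Longrightarrow> infinite {y\<in>M. adj c b x y}"
begin

abbreviation N :: "bool \<Rightarrow> nat \<Rightarrow> nat set" where
  "N b x \<equiv> {y\<in>M. adj c b x y}"

text \<open>The other integers of \<open>M\<close> that \<open>v\<close> reaches in colour
  \<open>b\<close> neither by an edge nor by infinitely many paths with two edges.\<close>

definition miss :: "bool \<Rightarrow> nat \<Rightarrow> nat set" where
  "miss b v = {x \<in> N (\<not> b) v. finite (N b v \<inter> N b x)}"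

lemma hosted: "hosted_forest V E \<pi> \<delta> (adj c b) M M"
proof unfold_locales
  show "infinite M"
    using M_ne degree[of _ b] by (metis (no_types, lifting) ex_in_conv finite_subset mem_Collect_eq subsetI)
  show "\<And>h. h \<in> M \<Longrightarrow> infinite (N b h)" by (rule degree)
qed (auto intro: adj_sym)

lemma miss_not: "z \<in> miss (\<not> b) v \<Longrightarrow> finite (N (\<not> b) v \<inter> N (\<not> b) z)"
  by (simp add: miss_def)

lemma miss_sub: "miss b v \<subseteq> N (\<not> b) v"
  by (auto simp: miss_def)

text \<open>All of \<open>miss b v\<close> is joined to \<open>v\<close> in colour
  \<open>\<not> b\<close>, and \<open>z\<close> shares only finitely many neighbours in that colour
  with \<open>v\<close>. So \<open>z\<close>, itself joined to \<open>v\<close> in colour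
  \<open>b\<close>, is joined in colour \<open>b\<close> to almost all of
  \<open>miss b v\<close>.\<close>

lemma miss_miss:
  assumes "z \<in> miss (\<not> b) v"
  shows "finite (miss b v \<inter> N (\<not> b) z)"
  using miss_not[OF assms] by (rule rev_finite_subset) (use miss_sub in blast)

lemma near:
  fixes b :: bool
  assumes s: "infinite {u\<in>kids s. kids u \<noteq> {}}"
    and g: "hosted_forest.partial_emb V \<pi> \<delta> (adj c b) M M g" "g s = Some v"
    and x: "x \<in> M - miss b v" "x \<notin> ran g" and Q: "finite Q" "x \<notin> Q"
  shows "\<exists>g'. hosted_forest.partial_emb V \<pi> \<delta> (adj c b) M M g' \<and> g \<subseteq>\<^sub>m g' \<and> x \<in> ran g' \<and> ran g' \<inter> Q \<subseteq> ran g"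
proof -
  interpret hosted_forest V E \<pi> \<delta> "adj c b" M M by (rule hosted)
  have "v \<noteq> x" using x g(2) by (auto simp: ran_def)
  from adj_cases[OF this, of c b] consider "adj c b v x" | "adj c (\<not> b) v x" by blast
  then show ?thesis
  proof cases
    case 1
    have "infinite (kids s)" using s by (rule contrapos_nn) (auto intro: finite_subset)
    then obtain g' where "partial_emb g'" "g \<subseteq>\<^sub>m g'" "ran g' = insert x (ran g)"
      using cover_child[OF g, of x] x 1 by auto
    then show ?thesis using Q by (intro exI[of _ g']) auto
  next
    case 2
    have "N b v \<inter> N b x = {z\<in>M. adj c b v z \<and> adj c b z x}" using adj_sym by blast
    then have "infinite {z\<in>M. adj c b v z \<and> adj c b z x}" using x(1) 2 by (auto simp: miss_def)
    then show ?thesis using cover_grandchild[OF g s, of x Q] x Q by auto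
  qed
qed

lemma spans_one_centre:
  assumes s: "s \<in> V" "\<delta> s = 0" "infinite {u\<in>kids s. kids u \<noteq> {}}" and v: "v \<in> M"
  shows "spans V E (adj c b) M (M - miss b v)"
proof -
  interpret hosted_forest V E \<pi> \<delta> "adj c b" M M by (rule hosted)
  obtain g0 where g0: "partial_emb g0" "g0 s = Some v" using place_root s v by blast
  show ?thesis
  proof (rule engine_base[OF g0(1)])
    fix g x assume g: "partial_emb g" "g0 \<subseteq>\<^sub>m g" "x \<in> M - miss b v" "x \<notin> ran g"
    then show "\<exists>g'. partial_emb g' \<and> g \<subseteq>\<^sub>m g' \<and> x \<in> ran g'"
      using near[OF s(3) g(1) map_le_Some[OF g(2) g0(2)] g(3,4), of "{}"] by auto
  qed
qed

text \<open>An element \<open>x\<close> of \<open>miss b v\<close> is reached by a path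
  \<open>v\<close>, \<open>z\<close>, \<open>n\<close>, \<open>x\<close> in colour \<open>b\<close>
  with \<open>z\<close> in \<open>miss (\<not> b) v\<close>. Because \<open>x\<close> is missed,
  almost every neighbour \<open>n\<close> of \<open>x\<close> in colour \<open>b\<close> is joined
  to \<open>v\<close> in the other colour, and hence, up to finitely many again, to \<open>z\<close>
  in colour \<open>b\<close>.\<close>

lemma spans_deep:
  assumes s: "s \<in> V" "\<delta> s = 0" "infinite {u\<in>kids s. \<exists>w\<in>kids u. kids w \<noteq> {}}" and v: "v \<in> M"
    and inf: "infinite (miss (\<not> b) v)"
  shows "spans V E (adj c b) M M"
proof -
  interpret hosted_forest V E \<pi> \<delta> "adj c b" M M by (rule hosted)
  have s': "infinite {u\<in>kids s. kids u \<noteq> {}}"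
    using s(3) by (rule contrapos_nn) (auto elim: rev_finite_subset)
  obtain g0 where g0: "partial_emb g0" "g0 s = Some v" using place_root s v by blast
  show ?thesis
  proof (rule engine_base[OF g0(1)])
    fix g x assume g: "partial_emb g" "g0 \<subseteq>\<^sub>m g" "x \<in> M" "x \<notin> ran g"
    have gs: "g s = Some v" using map_le_Some[OF g(2) g0(2)] .
    show "\<exists>g'. partial_emb g' \<and> g \<subseteq>\<^sub>m g' \<and> x \<in> ran g'"
    proof (cases "x \<in> miss b v")
      case False
      then show ?thesis using near[OF s' g(1) gs, of x "{}"] g(3,4) by auto
    next
      case True
      then have fin: "finite (N b x \<inter> N b v)" by (simp add: miss_def Int_commute)
      show ?thesis
      proof (rule cover_great_grandchild[OF g(1) gs s(3) g(3,4)])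
        fix Q :: "nat set" assume "finite Q"
        then have "infinite (miss (\<not> b) v - Q)" using inf by simp
        then obtain z where z: "z \<in> miss (\<not> b) v" "z \<notin> Q" using infinite_imp_nonempty by blast
        have "infinite (N b x - (N b x \<inter> N b v) - (N (\<not> b) v \<inter> N (\<not> b) z) - insert v (insert z Q))"
          using degree[OF g(3)] fin miss_not[OF z(1)] \<open>finite Q\<close> by (intro Diff_infinite_finite) auto
        then obtain n where n: "n \<in> N b x - (N b x \<inter> N b v) - (N (\<not> b) v \<inter> N (\<not> b) z) - insert v (insert z Q)"
          using infinite_imp_nonempty by blast
        then have "adj c (\<not> b) v n" using adj_cases[of v n c b] by auto
        then have "adj c b z n" using n adj_cases[of z n c b] by auto
        moreover have "z \<in> M" "adj c b v z" using z(1) by (auto simp: miss_def)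
        moreover have "adj c b n x" "n \<in> M" "z \<noteq> n" "n \<notin> Q" using n adj_sym by auto
        ultimately show "\<exists>z n. z \<in> M \<and> n \<in> M \<and> z \<noteq> n \<and> z \<notin> Q \<and> n \<notin> Q \<and> adj c b v z \<and> adj c b z n \<and> adj c b n x"
          using z(2) by blast
      qed
    qed
  qed
qed

text \<open>The hubs for \<open>leaf_trick\<close> are the elements of
  \<open>miss (\<not> b) v\<close>: they are joined to \<open>v\<close> in colour \<open>b\<close>,
  so they can host children of \<open>s\<close> with many leaves, and by \<open>miss_miss\<close>
  each is joined to almost all of \<open>miss b v\<close>. The integers outside
  \<open>miss b v\<close> are left to \<open>near\<close>.\<close>

lemma spans_star_children:
  assumes s: "s \<in> V" "\<delta> s = 0" "infinite {u\<in>kids s. kids u \<noteq> {}}" and v: "v \<in> M"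
    and stars: "\<And>n F. finite F \<Longrightarrow> \<exists>p\<in>kids s - F. \<exists>L\<subseteq>leaf_kids p. finite L \<and> card L = n"
    and inf: "infinite (miss (\<not> b) v)"
  shows "\<exists>X0. finite X0 \<and> spans V E (adj c b) M (M - X0)"
proof -
  interpret hosted_forest V E \<pi> \<delta> "adj c b" M M by (rule hosted)
  obtain g0 where g0: "partial_emb g0" "g0 s = Some v" using place_root s v by blast
  show ?thesis
  proof (rule leaf_trick[OF g0(1) inf, where Y = "miss b v"])
    show "miss b v \<subseteq> M" by (auto simp: miss_def)
  next
    fix z assume z: "z \<in> miss (\<not> b) v"
    have "{y \<in> miss b v. \<not> adj c b z y} \<subseteq> insert z (miss b v \<inter> N (\<not> b) z)"
      by (auto simp: miss_def adj_def)
    then show "finite {y \<in> miss b v. \<not> adj c b z y}"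
      using miss_miss[OF z] by (meson finite_insert finite_subset)
  next
    fix g :: "'a \<Rightarrow> nat option" and z n and Q :: "nat set"
    assume g: "partial_emb g" "g0 \<subseteq>\<^sub>m g" and z: "z \<in> miss (\<not> b) v" "z \<notin> ran g" and Q: "finite Q" "z \<notin> Q"
    have "finite (dom g)" using g by (simp add: partial_emb_def)
    then obtain p L where p: "p \<in> kids s" "g p = None" and L: "L \<subseteq> leaf_kids p" "finite L" "card L = n"
      using stars[of "dom g" n] by auto
    have "z \<in> M" "adj c b v z" using z(1) by (auto simp: miss_def)
    then obtain g2 where g2: "partial_emb g2" "g \<subseteq>\<^sub>m g2" "ran g2 = insert z (ran g)" "dom g2 = insert p (dom g)" "g2 p = Some z"
      using add_child[OF g(1) map_le_Some[OF g(2) g0(2)] p, of z] z by auto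
    have "L \<inter> dom g2 = {}"
    proof -
      have "g u = None \<and> u \<noteq> p" if "u \<in> L" for u
        using that L(1) kids_fresh[OF g(1) p(2)] kids_in[of u p] by (auto simp: leaf_kids_def)
      then show ?thesis using g2(4) by auto
    qed
    then show "\<exists>g' p L. partial_emb g' \<and> g \<subseteq>\<^sub>m g' \<and> g' p = Some z \<and> ran g' \<inter> Q \<subseteq> ran g \<and>
            L \<subseteq> leaf_kids p \<and> L \<inter> dom g' = {} \<and> finite L \<and> card L = n"
      using g2 L Q by (intro exI[of _ g2] exI[of _ p] exI[of _ L]) auto
  next
    fix g x Q assume g: "partial_emb g" "g0 \<subseteq>\<^sub>m g" "x \<in> M - miss b v" "x \<notin> ran g" "finite Q" "x \<notin> Q"
    then show "\<exists>g'. partial_emb g' \<and> g \<subseteq>\<^sub>m g' \<and> x \<in> ran g' \<and> ran g' \<inter> Q \<subseteq> ran g"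
      using near[OF s(3) g(1) map_le_Some[OF g(2) g0(2)] g(3-6)] by blast
  qed
qed

text \<open>Children and grandchildren of \<open>s\<close> cover everything outside
  \<open>miss b x\<close>, and leaves at \<open>t\<close> cover everything joined to
  \<open>y\<close> in colour \<open>b\<close>; only what escapes both is lost.\<close>

lemma spans_two_centres:
  assumes s: "infinite {u\<in>kids s. kids u \<noteq> {}}" and t: "infinite (leaf_kids t)"
    and g0: "hosted_forest.partial_emb V \<pi> \<delta> (adj c b) M M g0" "g0 s = Some x" "g0 t = Some y"
  shows "spans V E (adj c b) M (M - (miss b x \<inter> N (\<not> b) y))"
proof -
  interpret hosted_forest V E \<pi> \<delta> "adj c b" M M by (rule hosted)
  show ?thesis
  proof (rule engine_base[OF g0(1)])
    fix g z assume g: "partial_emb g" "g0 \<subseteq>\<^sub>m g" "z \<in> M - (miss b x \<inter> N (\<not> b) y)" "z \<notin> ran g"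
    have gs: "g s = Some x" "g t = Some y" using map_le_Some[OF g(2)] g0 by auto
    show "\<exists>g'. partial_emb g' \<and> g \<subseteq>\<^sub>m g' \<and> z \<in> ran g'"
    proof (cases "z \<in> miss b x")
      case False
      then show ?thesis using near[OF s g(1) gs(1), of z "{}"] g(3,4) by auto
    next
      case True
      moreover have "z \<noteq> y" using g(4) gs(2) by (auto simp: ran_def)
      ultimately have "adj c b y z" using g(3) adj_cases[of y z c b] by auto
      then show ?thesis using cover_leaf_kid[OF g(1) gs(2) t, of z] g(3,4) by auto
    qed
  qed
qed

lemma clique_path:
  assumes "distinct xs" "\<And>x y. x \<in> set xs \<Longrightarrow> y \<in> set xs \<Longrightarrow> x \<noteq> y \<Longrightarrow> adj c b x y"
  shows "successively (adj c b) xs"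
  using assms by (induction xs rule: induct_list012) auto

text \<open>If \<open>s\<close> sits at \<open>v\<close> and \<open>t\<close> at an element of
  \<open>miss (\<not> b) v\<close>, colour \<open>b\<close> loses only finitely many integers. For
  \<open>s\<close> and \<open>t\<close> in one component this needs a path of the right colour with
  exactly as many edges as the forest path from \<open>s\<close> to \<open>t\<close>. Such paths can
  be lengthened by two edges, so only the parity of the distance matters.\<close>

lemma spans_star_and_centre:
  assumes s: "s \<in> V" "\<delta> s = 0" "infinite {u\<in>kids s. kids u \<noteq> {}}"
    and t: "t \<in> V" "t \<noteq> s" "infinite (leaf_kids t)" and v: "v \<in> M"
    and inf: "\<And>b. infinite (miss b v)"
  shows "\<exists>b X0. finite X0 \<and> spans V E (adj c b) M (M - X0)"
proof -
  \<comment> \<open>The assumptions are symmetric in the two colours; this merely names one of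
    them.\<close>
  define b where "b = True"
  interpret hosted_forest V E \<pi> \<delta> "adj c b'" M M for b' by (rule hosted)
  have Diff_ex: "\<exists>z\<in>miss b' v. z \<notin> Q" if "finite Q" for Q b'
    using inf[of b'] that by (meson finite_subset subsetI)
  define l where "l = \<delta> t"
  define r where "r = (\<pi> ^^ l) t"
  have two_centres: "\<exists>b X0. finite X0 \<and> spans V E (adj c b) M (M - X0)"
    if "partial_emb b' g" "g s = Some v" "g t = Some z" "z \<in> miss (\<not> b') v" for b' g z
    using spans_two_centres[OF s(3) t(3) that(1-3)] miss_miss[OF that(4)] by blast
  show ?thesis
  proof (cases "r = s")
    \<comment> \<open>Now \<open>s\<close> and \<open>t\<close> lie in different components: the
      path from the root \<open>r\<close> to \<open>t\<close> is placed so that it ends in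
      \<open>z\<close>, and \<open>s\<close> is added at \<open>v\<close> as a separate
      root.\<close>
    case False
    obtain z where z: "z \<in> miss (\<not> b) v" using Diff_ex[of "{}" "\<not> b"] by auto
    then have zM: "z \<in> M" "z \<noteq> v" by (auto simp: miss_def adj_def)
    obtain ys where ys: "length ys = Suc l" "distinct ys" "set ys \<subseteq> M" "successively (adj c b) ys" "last ys = z" "set ys \<inter> {v} \<subseteq> {z}"
      using path_to[OF zM(1), where Q = "{v}" and n = l and b' = b] by auto
    obtain g where g: "partial_emb b g" "g t = Some z" "ran g = set ys" "\<forall>u\<in>dom g. \<exists>k\<le>l. u = (\<pi> ^^ k) t"
      using place_path[OF t(1), where ys = ys and b' = b] ys unfolding l_def by auto
    have gs: "g s = None"
    proof (rule ccontr)
      assume "g s \<noteq> None"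
      then obtain k where k: "k \<le> l" "s = (\<pi> ^^ k) t" using g(4) by (metis domIff)
      then have "k = l" using ancestor[OF t(1), of k] s(2) by (simp add: l_def)
      then show False using False k by (simp add: r_def)
    qed
    have "v \<notin> ran g" using g(3) ys(6) zM by auto
    then obtain g' where g': "partial_emb b g'" "g \<subseteq>\<^sub>m g'" "g' s = Some v"
      using add_vertex[OF g(1) s(1) gs v] v s(2) by auto
    show ?thesis using two_centres[OF g'(1,3) map_le_Some[OF g'(2) g(2)] z] .
  next
    case True
    have l0: "l \<noteq> 0" using True t(2) by (cases "l = 0") (auto simp: r_def)
    have placed: "\<exists>g. partial_emb b' g \<and> g s = Some (hd ys) \<and> g t = Some (last ys)"
      if "length ys = Suc l" "distinct ys" "set ys \<subseteq> M" "successively (adj c b') ys" for ys b'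
      using place_path[OF t(1), where ys = ys and b' = b'] that True unfolding l_def r_def by auto
    define W where "W = miss b v"
    \<comment> \<open>\<open>P k\<close> gives a path of \<open>k\<close> edges in colour
      \<open>\<not> b\<close> from \<open>v\<close> into \<open>W = miss b v\<close>. For
      \<open>k = l\<close> it places both centres as required for the colour
      \<open>\<not> b\<close>.\<close>
    define P where "P k \<longleftrightarrow> (\<exists>ys. length ys = Suc k \<and> distinct ys \<and> set ys \<subseteq> M \<and> successively (adj c (\<not> b)) ys \<and>
        hd ys = v \<and> last ys \<in> W)" for k
    have P_done: ?thesis if Pl: "P l"
    proof -
      obtain ys where ys: "length ys = Suc l" "distinct ys" "set ys \<subseteq> M" "successively (adj c (\<not> b)) ys"
          "hd ys = v" "last ys \<in> W" using Pl unfolding P_def by blast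
      then show ?thesis using placed[OF ys(1-4)] two_centres[of "\<not> b"] unfolding W_def by auto
    qed
    have W_fin: "finite (N b v \<inter> N b w)" "adj c (\<not> b) v w" "w \<in> M" if "w \<in> W" for w
      using that by (auto simp: W_def miss_def)
    have P_step: "P (Suc (Suc k))" if Pk: "P k" for k
    proof -
      obtain ys where ys: "length ys = Suc k" "distinct ys" "set ys \<subseteq> M" "successively (adj c (\<not> b)) ys"
          "hd ys = v" "last ys \<in> W" using Pk unfolding P_def by blast
      define w where "w = last ys"
      have w: "w \<in> W" using ys by (simp add: w_def)
      obtain w' where w': "w' \<in> W" "w' \<notin> set ys" using Diff_ex[of "set ys" b] unfolding W_def by auto
      have "infinite (N b v - (N b v \<inter> N b w) - (N b v \<inter> N b w') - insert w' (set ys))"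
        using degree[OF v] W_fin[OF w] W_fin[OF w'(1)] by (intro Diff_infinite_finite) auto
      then obtain m where m: "m \<in> N b v - (N b v \<inter> N b w) - (N b v \<inter> N b w') - insert w' (set ys)"
        using infinite_imp_nonempty by blast
      have "ys \<noteq> []" using ys(1) by auto
      then have "w \<in> set ys" by (simp add: w_def)
      then have "adj c (\<not> b) w m" "adj c (\<not> b) m w'"
        using m adj_cases[of w m c b] adj_cases[of w' m c b] adj_sym by auto
      then show ?thesis
        unfolding P_def using ys m w' W_fin \<open>ys \<noteq> []\<close>
        by (intro exI[of _ "ys @ [m, w']"]) (auto simp: successively_append_iff w_def)
    qed
    have P1: "P 1"
    proof -
      obtain w where "w \<in> W" using Diff_ex[of "{}" b] unfolding W_def by auto
      then show ?thesis unfolding P_def using W_fin[of w] v by (intro exI[of _ "[v, w]"]) (auto simp: adj_def)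
    qed
    have P_odd: "P k" if "odd k" for k
      using that by (induction k rule: induct_nat_012) (use P1 P_step in auto)
    consider (odd) "odd l" | (link) "even l" "\<exists>n\<in>N (\<not> b) v. \<exists>w\<in>W. adj c (\<not> b) n w"
      | (clique) "even l" "\<And>n w. n \<in> N (\<not> b) v \<Longrightarrow> w \<in> W \<Longrightarrow> \<not> adj c (\<not> b) n w" by blast
    then show ?thesis
    proof cases
      case odd
      then show ?thesis using P_odd P_done by blast
    next
      case link
      then obtain n w where nw: "n \<in> N (\<not> b) v" "w \<in> W" "adj c (\<not> b) n w" by blast
      then have P2: "P 2" unfolding P_def using W_fin[of w] v
        by (intro exI[of _ "[v, n, w]"]) (auto simp: adj_def)
      have "P (2 * Suc k)" for k
        by (induction k) (use P2 P_step in \<open>auto simp: numeral_2_eq_2\<close>)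
      moreover obtain k where "l = 2 * Suc k" using link(1) l0 by (metis dvdE mult_0_right not0_implies_Suc)
      ultimately show ?thesis using P_done by blast
    next
      case clique
      \<comment> \<open>\<open>W\<close> is now a clique of colour \<open>b\<close>, so any path length is available, and the roles of
        the two centres are exchanged: \<open>s\<close> goes into \<open>W\<close> and \<open>t\<close> to \<open>v\<close>.\<close>
      have adj_W: "adj c b n w" if "n \<in> N (\<not> b) v" "w \<in> W" "n \<noteq> w" for n w
        using clique(2)[OF that(1,2)] adj_cases[OF that(3)] by blast
      obtain z where z: "z \<in> miss (\<not> b) v" using Diff_ex[of "{}" "\<not> b"] by auto
      have zv: "adj c b v z" "z \<in> M" using z by (auto simp: miss_def)
      have "infinite (W - (W \<inter> N (\<not> b) z) - {z})"
        using miss_miss[OF z] inf[of b] unfolding W_def by (intro Diff_infinite_finite) auto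
      from infinite_arbitrarily_large[OF this, of "l - 1"]
      obtain T where T: "T \<subseteq> W - (W \<inter> N (\<not> b) z) - {z}" "finite T" "card T = l - 1" by auto
      define ws where "ws = sorted_list_of_set T"
      have ws: "set ws = T" "distinct ws" "length ws = l - 1" using T by (auto simp: ws_def)
      have W_M: "W \<subseteq> N (\<not> b) v" unfolding W_def by (rule miss_sub)
      have vz: "adj c b w z" if "w \<in> T" for w
      proof (rule adj_sym)
        show "adj c b z w" using that T(1) W_M adj_cases[of z w c b] by blast
      qed
      have "l \<ge> 2" using clique(1) l0 by (cases "l = 1") auto
      then have ne: "ws \<noteq> []" using ws(3) by auto
      have "successively (adj c b) ws"
      proof (rule clique_path)
        show "adj c b x y" if "x \<in> set ws" "y \<in> set ws" "x \<noteq> y" for x y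
          by (rule adj_W) (use that ws(1) T(1) W_M in blast)+
      qed (rule ws(2))
      \<comment> \<open>With \<open>l - 1\<close> elements of \<open>W\<close> followed by
        \<open>z\<close> and \<open>v\<close>, this path has exactly \<open>l\<close> edges.\<close>
      then have "successively (adj c b) (ws @ [z, v])"
        using vz[of "last ws"] ne ws(1) zv adj_sym[OF zv(1)] by (auto simp: successively_append_iff)
      moreover have "z \<notin> T" "v \<notin> T" "z \<noteq> v" using T(1) W_M zv by (auto simp: adj_def)
      moreover have "T \<subseteq> M" using T(1) W_M by auto
      ultimately obtain g where g: "partial_emb b g" "g s = Some (hd ws)" "g t = Some v"
        using placed[of "ws @ [z, v]" b] ws \<open>l \<ge> 2\<close> v zv ne by auto
      have "hd ws \<in> W" using ne ws(1) T(1) by (metis DiffD1 hd_in_set subsetD)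
      \<comment> \<open>An element of the intersection would lie in \<open>N (\<not> b) v\<close>
        and be joined in colour \<open>\<not> b\<close> to \<open>hd ws\<close>, an element of
        \<open>W\<close>; the case assumption excludes this.\<close>
      then have "miss b (hd ws) \<inter> N (\<not> b) v \<subseteq> {}"
        using clique(2)[of _ "hd ws"] adj_sym[of c "\<not> b"] unfolding miss_def by blast
      then have "finite (miss b (hd ws) \<inter> N (\<not> b) v)" by (rule finite_subset) simp
      then show ?thesis using spans_two_centres[OF s(3) t(3) g] by blast
    qed
  qed
qed

end

section \<open>Robust connectivity and forests of unbounded depth\<close>

lemma spans_mono: "spans V E A M X \<Longrightarrow> M \<subseteq> M' \<Longrightarrow> X' \<subseteq> X \<Longrightarrow> spans V E A M' X'"
  unfolding spans_def by (meson subset_trans)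

definition restr :: "(nat \<Rightarrow> nat \<Rightarrow> bool) \<Rightarrow> nat set \<Rightarrow> nat \<Rightarrow> nat \<Rightarrow> bool" where
  "restr A S x y \<longleftrightarrow> A x y \<and> x \<in> S \<and> y \<in> S"

definition robustly_connected :: "(nat \<Rightarrow> nat \<Rightarrow> bool) \<Rightarrow> nat set \<Rightarrow> bool" where
  "robustly_connected A S \<longleftrightarrow>
     (\<forall>Q x y. finite Q \<longrightarrow> x \<in> S - Q \<longrightarrow> y \<in> S - Q \<longrightarrow> (restr A (S - Q))\<^sup>*\<^sup>* x y)"

context rooted_forest
begin

definition up_closed :: "'a set \<Rightarrow> bool" where
  "up_closed F \<longleftrightarrow> finite F \<and> F \<subseteq> V \<and> (\<forall>v\<in>F. \<delta> v \<noteq> 0 \<longrightarrow> \<pi> v \<in> F)"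

text \<open>For a parent-closed \<open>F\<close> a nearest element of \<open>F\<close> is found
  among the ancestors, so this says that every vertex is at distance at most \<open>d\<close> from
  \<open>F\<close>.\<close>

definition reaches :: "nat \<Rightarrow> 'a set \<Rightarrow> bool" where
  "reaches d F \<longleftrightarrow> (\<forall>w\<in>V. \<exists>k\<le>d. k \<le> \<delta> w \<and> (\<pi> ^^ k) w \<in> F)"

end

text \<open>To cover \<open>x\<close>, a path to \<open>x\<close> avoiding the other used integers
  is fixed for each used integer. By \<open>deep\<close> some \<open>w\<close> lies far below
  everything placed. Either no ancestor of \<open>w\<close> is placed, and its root goes to
  \<open>x\<close>; or the path starting at the image of its lowest placed ancestor is laid along
  the way down to \<open>w\<close>.\<close>

lemma (in hosted_forest) spans_unbounded_depth:
  assumes H: "H = M" and conn: "robustly_connected A M"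
    and deep: "\<And>d F. up_closed F \<Longrightarrow> \<not> reaches d F"
  shows "spans V E A M M"
proof (rule engine_base[OF partial_emb_empty])
  fix g x assume g: "partial_emb g" and x: "x \<in> M" "x \<notin> ran g"
  have "up_closed (dom g)" using g by (auto simp: up_closed_def partial_emb_def)
  have path: "\<exists>ys. successively A (y # ys) \<and> distinct (y # ys) \<and> set ys \<subseteq> M - ran g \<and> x \<in> set ys"
    if y: "y \<in> ran g" for y
  proof -
    have "y \<in> M" using g y by (auto simp: partial_emb_def)
    then have "(restr A (M - (ran g - {y})))\<^sup>*\<^sup>* y x"
      using conn x y finite_ran_emb[OF g] unfolding robustly_connected_def by auto
    from rtranclp_distinct_path[OF this] obtain zs where zs: "distinct zs"
        "successively (restr A (M - (ran g - {y}))) zs" "zs \<noteq> []" "hd zs = y" "last zs = x" by blast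
    then obtain ys where ys: "zs = y # ys" by (cases zs) auto
    have "ys \<noteq> []" using zs ys x y by auto
    have "z \<in> M - ran g" if z: "z \<in> set ys" for z
    proof -
      obtain as bs where "ys = as @ z # bs" using z by (meson split_list)
      then have "z \<in> M - (ran g - {y})" using zs(2) ys
        by (cases as rule: rev_cases) (auto simp: successively_append_iff successively_Cons restr_def)
      moreover have "z \<noteq> y" using z zs(1) ys by auto
      ultimately show ?thesis by auto
    qed
    moreover have "successively A (y # ys)"
      using zs(2) ys by (auto elim: successively_mono simp: restr_def)
    moreover have "x \<in> set ys" using zs(5) ys \<open>ys \<noteq> []\<close> by auto
    ultimately show ?thesis using zs(1) ys by blast
  qed
  then obtain p where p: "\<And>y. y \<in> ran g \<Longrightarrow> successively A (y # p y) \<and> distinct (y # p y) \<and> set (p y) \<subseteq> M - ran g \<and> x \<in> set (p y)"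
    by metis
  \<comment> \<open>The lengths are bounded before \<open>w\<close> is chosen, since the image of
    the placed ancestor of \<open>w\<close> is not known in advance.\<close>
  obtain d where d: "\<And>y. y \<in> ran g \<Longrightarrow> length (p y) < d"
    using finite_nat_bounded[of "(\<lambda>y. length (p y)) ` ran g"] finite_ran_emb[OF g] by (auto simp: image_subset_iff)
  obtain w where w: "w \<in> V" "\<And>k. k \<le> d \<Longrightarrow> k \<le> \<delta> w \<Longrightarrow> (\<pi> ^^ k) w \<notin> dom g"
    using deep[OF \<open>up_closed (dom g)\<close>, of d] unfolding reaches_def by blast
  show "\<exists>g'. partial_emb g' \<and> g \<subseteq>\<^sub>m g' \<and> x \<in> ran g'"
  proof (cases "\<exists>k\<le>\<delta> w. (\<pi> ^^ k) w \<in> dom g")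
    case False
    let ?r = "(\<pi> ^^ \<delta> w) w"
    have "?r \<in> V" "\<delta> ?r = 0" "g ?r = None" using ancestor[OF w(1), of "\<delta> w"] False by auto
    then show ?thesis using add_vertex[OF g, of ?r x] x H by auto
  next
    case True
    define k where "k = (LEAST k. k \<le> \<delta> w \<and> (\<pi> ^^ k) w \<in> dom g)"
    have k: "k \<le> \<delta> w" "(\<pi> ^^ k) w \<in> dom g" using LeastI_ex[OF True] unfolding k_def by auto
    have below: "g ((\<pi> ^^ i) w) = None" if i: "i < k" for i
      using not_less_Least[OF i[unfolded k_def]] i k(1) by (auto simp: domIff)
    have "d < k" using w(2)[of k] k by force
    obtain y where y: "g ((\<pi> ^^ k) w) = Some y" using k by blast
    then have yr: "y \<in> ran g" by (auto simp: ran_def)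
    have "\<exists>g'. partial_emb g' \<and> g \<subseteq>\<^sub>m g' \<and> set (p y) \<subseteq> ran g'"
      by (rule cover_path[OF g y, where w = w and k = k])
        (use p[OF yr] d[OF yr] \<open>d < k\<close> k w(1) H below in auto)
    then show ?thesis using p[OF yr] by blast
  qed
qed

context coloured_forest
begin

text \<open>If deleting a finite \<open>Q\<close> disconnects colour \<open>True\<close>, infinite
  degrees make both one component and the rest of \<open>M - Q\<close> infinite. All edges between
  the two have colour \<open>False\<close>, and a complete bipartite graph with two infinite sides
  stays connected when finitely many vertices are deleted.\<close>

lemma robustly_connected_colour:
  "robustly_connected (adj c True) M \<or> (\<exists>Q. finite Q \<and> robustly_connected (adj c False) (M - Q))"
proof (rule disjCI)
  assume no: "\<not> (\<exists>Q. finite Q \<and> robustly_connected (adj c False) (M - Q))"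
  show "robustly_connected (adj c True) M"
    unfolding robustly_connected_def
  proof (intro allI impI, rule ccontr)
    fix Q x y assume Q: "finite Q" and x: "x \<in> M - Q" and y: "y \<in> M - Q"
      and nc: "\<not> (restr (adj c True) (M - Q))\<^sup>*\<^sup>* x y"
    let ?R = "restr (adj c True) (M - Q)"
    have sym: "?R\<^sup>*\<^sup>* b a" if "?R\<^sup>*\<^sup>* a b" for a b
      using that by induction (auto intro: converse_rtranclp_into_rtranclp simp: restr_def dest: adj_sym)
    have comp_inf: "infinite {z\<in>M - Q. ?R\<^sup>*\<^sup>* a z}" if a: "a \<in> M - Q" for a
    proof -
      have "infinite (N True a - Q)" using degree[of a True] a Q by simp
      moreover have "N True a - Q \<subseteq> {z\<in>M - Q. ?R\<^sup>*\<^sup>* a z}" using a by (auto simp: restr_def)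
      ultimately show ?thesis using finite_subset by blast
    qed
    define P where "P = {z\<in>M - Q. ?R\<^sup>*\<^sup>* x z}"
    define P' where "P' = M - Q - P"
    have inf: "infinite P" unfolding P_def by (rule comp_inf[OF x])
    have "{z\<in>M - Q. ?R\<^sup>*\<^sup>* y z} \<subseteq> P'"
      unfolding P'_def P_def using nc sym rtranclp_trans[of ?R x _ y] by blast
    then have inf': "infinite P'" using comp_inf[OF y] finite_subset by blast
    have cross: "adj c False a b" if "a \<in> P" "b \<in> P'" for a b
    proof -
      have "\<not> ?R a b" using that rtranclp.rtrancl_into_rtrancl[of ?R x a b] unfolding P_def P'_def by blast
      then have "\<not> adj c True a b" using that unfolding P_def P'_def by (simp add: restr_def)
      moreover have "a \<noteq> b" using that unfolding P'_def by auto
      ultimately show ?thesis by (auto simp: adj_def)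
    qed
    have "robustly_connected (adj c False) (M - Q)"
      unfolding robustly_connected_def
    proof (intro allI impI)
      fix Q' a b assume Q': "finite Q'" and ab: "a \<in> M - Q - Q'" "b \<in> M - Q - Q'"
      let ?B = "restr (adj c False) (M - Q - Q')"
      obtain u u' where u: "u \<in> P - Q'" and u': "u' \<in> P' - Q'"
        using inf inf' Q' by (metis Diff_infinite_finite infinite_imp_nonempty ex_in_conv)
      have MQ: "P \<subseteq> M - Q" "P' \<subseteq> M - Q" "M - Q \<subseteq> P \<union> P'" by (auto simp: P_def P'_def)
      have B: "?B p p'" "?B p' p" if "p \<in> P - Q'" "p' \<in> P' - Q'" for p p'
        using that cross[of p p'] MQ adj_sym by (auto simp: restr_def)
      have to_u: "?B\<^sup>*\<^sup>* z u \<and> ?B\<^sup>*\<^sup>* u z" if z: "z \<in> M - Q - Q'" for z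
      proof (cases "z \<in> P")
        case True
        then have "?B z u'" "?B u' z" using B(1)[of z u'] B(2)[of z u'] u' z by auto
        moreover have "?B u u'" "?B u' u" using B[OF u u'] by auto
        ultimately show ?thesis by (meson converse_rtranclp_into_rtranclp r_into_rtranclp)
      next
        case False
        then have "z \<in> P' - Q'" using z MQ by auto
        then show ?thesis using B[OF u] by blast
      qed
      show "?B\<^sup>*\<^sup>* a b" using to_u[OF ab(1)] to_u[OF ab(2)] by (meson rtranclp_trans)
    qed
    then show False using no Q by blast
  qed
qed

lemma spans_unbounded_depth:
  assumes deep: "\<And>d F. up_closed F \<Longrightarrow> \<not> reaches d F"
  shows "\<exists>b X0. finite X0 \<and> spans V E (adj c b) M (M - X0)"
proof -
  obtain b Q where bQ: "finite Q" "robustly_connected (adj c b) (M - Q)"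
    using robustly_connected_colour by (metis Diff_empty finite.emptyI)
  have "coloured_forest V E \<pi> \<delta> c (M - Q)"
  proof unfold_locales
    have "infinite (M - Q)"
      using hosted[of True] bQ(1) unfolding hosted_forest_def hosted_forest_axioms_def by simp
    then show "M - Q \<noteq> {}" by (rule infinite_imp_nonempty)
  next
    fix x b assume "x \<in> M - Q"
    then have "infinite (N b x - Q)" using degree[of x b] bQ(1) by simp
    moreover have "N b x - Q = {y \<in> M - Q. adj c b x y}" by auto
    ultimately show "infinite {y \<in> M - Q. adj c b x y}" by simp
  qed
  then interpret h: hosted_forest V E \<pi> \<delta> "adj c b" "M - Q" "M - Q"
    by (rule coloured_forest.hosted)
  have "spans V E (adj c b) (M - Q) (M - Q)"
    by (rule h.spans_unbounded_depth[OF refl bQ(2) deep])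
  then have "spans V E (adj c b) M (M - Q)" by (rule spans_mono) auto
  then show ?thesis using bQ(1) by blast
qed

end

section \<open>Structure of strongly contracting forests\<close>

lemma forest_no_4_cycle:
  assumes "forest V E" "E a p" "E a q" "E a' p" "E a' q" "p \<noteq> q"
  shows "a = a'"
proof (rule ccontr)
  assume "a \<noteq> a'"
  have sg: "u \<in> V" "v \<in> V" "u \<noteq> v" "E v u" if "E u v" for u v
    using assms(1) that unfolding forest_def simple_graph_def by blast+
  have e: "E p a'" "E a' q" "E q a" using assms sg(4) by blast+
  have "successively E [a, p, a', q]" using assms(2) e by simp
  moreover have "distinct [a, p, a', q]"
    using \<open>a \<noteq> a'\<close> assms(6) sg(3)[OF assms(2)] sg(3)[OF assms(3)] sg(3)[OF assms(4)] sg(3)[OF assms(5)] by simp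
  moreover have "set [a, p, a', q] \<subseteq> V" using sg(1,2)[OF assms(2)] sg(1,2)[OF assms(5)] by simp
  ultimately have "is_cycle V E [a, p, a', q]"
    unfolding is_cycle_def successively_conv_nth using e(3) by simp
  then show False using assms(1) unfolding forest_def by blast
qed

text \<open>A vertex of an independent set with at most \<open>k\<close> neighbours in total is
  isolated, or a leaf at one of these \<open>k\<close> vertices, or adjacent to two of them. Without
  4-cycles the last kind numbers at most \<open>k * k\<close>, so bounds on the first two kinds
  would bound the whole set.\<close>

lemma strongly_contracting_leaves:
  assumes fo: "forest V E" and sc: "strongly_contracting V E"
  shows "infinite {v\<in>V. nbhd E v = {}} \<or> (\<forall>n. \<exists>p\<in>V. card_ge (leaf_nbrs E p) n)"
proof (rule ccontr)
  assume "\<not> ?thesis"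
  then obtain n where I: "finite {v\<in>V. nbhd E v = {}}" and n: "\<And>p. p \<in> V \<Longrightarrow> \<not> card_ge (leaf_nbrs E p) n"
    by blast
  obtain k where k: "\<And>l. \<exists>A. independent V E A \<and> card_ge A l \<and> finite (nbhd_set E A) \<and> card (nbhd_set E A) \<le> k"
    using sc unfolding strongly_contracting_def by blast
  define i where "i = card {v\<in>V. nbhd E v = {}}"
  obtain A where A: "independent V E A" "card_ge A (Suc (i + k * n + k * k))" "finite (nbhd_set E A)" "card (nbhd_set E A) \<le> k"
    using k by blast
  let ?N = "nbhd_set E A"
  define B where "B = {a\<in>A. \<exists>p q. p \<noteq> q \<and> E a p \<and> E a q}"
  have NV: "?N \<subseteq> V" using fo by (auto simp: nbhd_set_def nbhd_def forest_def simple_graph_def)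
  have "\<exists>p q. p \<noteq> q \<and> E a p \<and> E a q" if "a \<in> B" for a using that by (auto simp: B_def)
  then obtain p q where pq: "\<And>a. a \<in> B \<Longrightarrow> p a \<noteq> q a \<and> E a (p a) \<and> E a (q a)" by metis
  \<comment> \<open>Two vertices with the same pair of neighbours would form a 4-cycle with
    it.\<close>
  have "inj_on (\<lambda>a. (p a, q a)) B"
    using pq forest_no_4_cycle[OF fo] by (intro inj_onI) (metis Pair_inject)
  moreover have "(\<lambda>a. (p a, q a)) ` B \<subseteq> ?N \<times> ?N"
    using pq by (auto simp: nbhd_set_def nbhd_def B_def)
  ultimately have B: "finite B" "card B \<le> card (?N \<times> ?N)"
    using A(3) by (meson finite_SigmaI inj_on_finite, meson finite_SigmaI card_inj_on_le)
  have L: "finite (leaf_nbrs E p)" "card (leaf_nbrs E p) \<le> n" if "p \<in> ?N" for p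
    using n[of p] that NV by (auto simp: card_ge_def)
  have "A \<subseteq> {v\<in>V. nbhd E v = {}} \<union> (\<Union>p\<in>?N. leaf_nbrs E p) \<union> B"
  proof
    fix a assume a: "a \<in> A"
    then have "a \<in> V" using A(1) by (auto simp: independent_def)
    consider "nbhd E a = {}" | p where "nbhd E a = {p}" | p q where "p \<noteq> q" "p \<in> nbhd E a" "q \<in> nbhd E a"
      by blast
    then show "a \<in> {v\<in>V. nbhd E v = {}} \<union> (\<Union>p\<in>?N. leaf_nbrs E p) \<union> B"
    proof cases
      case 2
      then have "E a p" "is_leaf E a" by (auto simp: nbhd_def is_leaf_def)
      moreover from this have "E p a" using fo by (simp add: forest_def simple_graph_def)
      moreover have "p \<in> ?N" using a \<open>E a p\<close> by (auto simp: nbhd_set_def nbhd_def)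
      ultimately show ?thesis by (auto simp: leaf_nbrs_def)
    qed (use a \<open>a \<in> V\<close> in \<open>auto simp: B_def nbhd_def\<close>)
  qed
  moreover have fin: "finite ({v\<in>V. nbhd E v = {}} \<union> (\<Union>p\<in>?N. leaf_nbrs E p) \<union> B)"
    using I B A(3) L by simp
  ultimately have "finite A" "card A \<le> card ({v\<in>V. nbhd E v = {}} \<union> (\<Union>p\<in>?N. leaf_nbrs E p) \<union> B)"
    by (auto intro: finite_subset card_mono)
  moreover have "card ({v\<in>V. nbhd E v = {}} \<union> (\<Union>p\<in>?N. leaf_nbrs E p) \<union> B)
      \<le> card ({v\<in>V. nbhd E v = {}} \<union> (\<Union>p\<in>?N. leaf_nbrs E p)) + card B" by (rule card_Un_le)
  moreover have "card ({v\<in>V. nbhd E v = {}} \<union> (\<Union>p\<in>?N. leaf_nbrs E p)) \<le> i + card (\<Union>p\<in>?N. leaf_nbrs E p)"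
    unfolding i_def by (rule card_Un_le)
  moreover have "card (\<Union>p\<in>?N. leaf_nbrs E p) \<le> k * n"
  proof -
    have "card (\<Union>p\<in>?N. leaf_nbrs E p) \<le> (\<Sum>p\<in>?N. card (leaf_nbrs E p))" by (rule card_UN_le[OF A(3)])
    also have "\<dots> \<le> (\<Sum>p\<in>?N. n)" using L by (intro sum_mono) auto
    also have "\<dots> \<le> k * n" using A(4) by simp
    finally show ?thesis .
  qed
  moreover have "card B \<le> k * k" 
    using B(2) A(4) mult_le_mono[OF A(4) A(4)] by (simp add: card_cartesian_product)
  ultimately show False using A(2) by (auto simp: card_ge_def)
qed

text \<open>This and the next two notions mention no rooting: a centre is found in one rooting of
  the forest, and the embedding is then built in another, rooted at that centre.\<close>

definition deep_centre :: "('a \<Rightarrow> 'a \<Rightarrow> bool) \<Rightarrow> 'a \<Rightarrow> bool" where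
  "deep_centre E s \<longleftrightarrow> infinite {u. E s u \<and> (\<exists>w x. E u w \<and> w \<noteq> s \<and> E w x \<and> x \<noteq> u)}"

definition centre :: "('a \<Rightarrow> 'a \<Rightarrow> bool) \<Rightarrow> 'a \<Rightarrow> bool" where
  "centre E s \<longleftrightarrow> infinite {u. E s u \<and> \<not> is_leaf E u}"

definition star_centre :: "('a \<Rightarrow> 'a \<Rightarrow> bool) \<Rightarrow> 'a \<Rightarrow> bool" where
  "star_centre E s \<longleftrightarrow> (\<forall>n. \<exists>p. E s p \<and> finite (leaf_nbrs E p) \<and> n \<le> card (leaf_nbrs E p))"

section \<open>Radius reduction and the three types of forest\<close>

lemma finite_bound:
  fixes f :: "'b \<Rightarrow> nat"
  assumes "finite F"
  shows "\<exists>m. \<forall>x\<in>F. f x < m"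
  using finite_nat_bounded[of "f ` F"] assms by auto

context rooted_forest
begin

lemma up_closed_kid: "up_closed F \<Longrightarrow> x \<in> kids v \<Longrightarrow> x \<in> F \<Longrightarrow> v \<in> F"
  unfolding up_closed_def kids_def by blast

lemma up_closed_add_kids:
  assumes "up_closed F" "finite K" "\<And>u. u \<in> K \<Longrightarrow> \<exists>s\<in>F. u \<in> kids s"
  shows "up_closed (F \<union> K)"
  using assms unfolding up_closed_def kids_def by blast

lemma centre_of_kids:
  assumes "infinite {u\<in>kids s. kids u \<noteq> {}}"
  shows "centre E s"
proof -
  have "{u\<in>kids s. kids u \<noteq> {}} \<subseteq> {u. E s u \<and> \<not> is_leaf E u}"
  proof
    fix u assume "u \<in> {u\<in>kids s. kids u \<noteq> {}}"
    then obtain x where u: "u \<in> kids s" and x: "x \<in> kids u" by blast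
    have "s \<in> nbhd E u" "x \<in> nbhd E u"
      using kids_edge[OF u] kids_edge[OF x] graph by (auto simp: nbhd_def simple_graph_def)
    moreover have "\<delta> x = Suc (Suc (\<delta> s))" using kids_in[OF u] kids_in[OF x] by simp
    then have "x \<noteq> s" by auto
    ultimately have "\<not> is_leaf E u" unfolding is_leaf_def by (metis card_1_singletonE singletonD)
    then show "u \<in> {u. E s u \<and> \<not> is_leaf E u}" using kids_edge[OF u] by blast
  qed
  then show ?thesis using assms unfolding centre_def by (meson finite_subset)
qed

lemma ancestor_kid:
  assumes "w \<in> V" "Suc k \<le> \<delta> w"
  shows "(\<pi> ^^ k) w \<in> kids ((\<pi> ^^ Suc k) w)"
  using ancestor[OF assms(1), of k] assms(2) by (auto simp: kids_def)

text \<open>If the ancestor of \<open>w\<close> at distance \<open>Suc d\<close> is in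
  \<open>F\<close>, then \<open>step\<close> puts its child on the way to \<open>w\<close> into
  \<open>K\<close>. Adding the finite sets \<open>K s\<close> to \<open>F\<close> therefore lowers
  the radius by one.\<close>

lemma reaches_decrease:
  assumes F: "up_closed F" "reaches (Suc d) F"
    and K: "\<And>s. s \<in> F \<Longrightarrow> finite (K s)" "\<And>s. K s \<subseteq> kids s"
    and step: "\<And>w. w \<in> V \<Longrightarrow> Suc d \<le> \<delta> w \<Longrightarrow> (\<pi> ^^ Suc d) w \<in> F \<Longrightarrow> (\<pi> ^^ d) w \<in> K ((\<pi> ^^ Suc d) w)"
  shows "\<exists>F. up_closed F \<and> reaches d F"
proof (intro exI conjI)
  show "up_closed (F \<union> (\<Union>s\<in>F. K s))"
    using F(1) K by (intro up_closed_add_kids) (auto simp: up_closed_def)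
  show "reaches d (F \<union> (\<Union>s\<in>F. K s))"
    unfolding reaches_def
  proof
    fix w assume w: "w \<in> V"
    then obtain k where k: "k \<le> Suc d" "k \<le> \<delta> w" "(\<pi> ^^ k) w \<in> F" using F(2) unfolding reaches_def by blast
    show "\<exists>k\<le>d. k \<le> \<delta> w \<and> (\<pi> ^^ k) w \<in> F \<union> (\<Union>s\<in>F. K s)"
    proof (cases "k = Suc d")
      case True
      then have "(\<pi> ^^ d) w \<in> (\<Union>s\<in>F. K s)" using step[OF w] k by blast
      then show ?thesis using k True by (intro exI[of _ d]) auto
    next
      case False
      then show ?thesis using k by (intro exI[of _ k]) auto
    qed
  qed
qed

lemma dominating_if_reaches:
  assumes F: "up_closed F" "reaches 1 F"
  shows "has_finite_dominating_set V E"
proof -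
  have "\<exists>x\<in>F. E v x" if v: "v \<in> V - F" for v
  proof -
    obtain k where k: "k \<le> 1" "k \<le> \<delta> v" "(\<pi> ^^ k) v \<in> F" using F(2) v unfolding reaches_def by blast
    then have "k = 1" using v by (cases k) auto
    then show ?thesis using k parent(3)[of v] v by auto
  qed
  then show ?thesis using F(1) unfolding has_finite_dominating_set_def dominating_def up_closed_def by blast
qed

text \<open>Vertices at distance \<open>d + 3\<close> lie below children of elements of
  \<open>F\<close> that carry two further levels. If each element of \<open>F\<close> had only
  finitely many such children, adding them would lower the radius, against minimality.\<close>

lemma deep_centre_if_reaches:
  assumes F: "up_closed F" "reaches (Suc (Suc (Suc d))) F"
    and min: "\<And>F. up_closed F \<Longrightarrow> \<not> reaches (Suc (Suc d)) F"
  shows "\<exists>s\<in>V. deep_centre E s"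
proof -
  define K where "K s = {u\<in>kids s. \<exists>w\<in>kids u. kids w \<noteq> {}}" for s
  have "\<exists>s\<in>F. infinite (K s)"
  proof (rule ccontr)
    assume "\<not> ?thesis"
    then have "finite (K s)" if "s \<in> F" for s using that by blast
    then have "\<exists>F. up_closed F \<and> reaches (Suc (Suc d)) F"
    proof (rule reaches_decrease[OF F])
      fix w assume "w \<in> V" "Suc (Suc (Suc d)) \<le> \<delta> w"
      then show "(\<pi> ^^ Suc (Suc d)) w \<in> K ((\<pi> ^^ Suc (Suc (Suc d))) w)"
        using ancestor_kid[of w d] ancestor_kid[of w "Suc d"] ancestor_kid[of w "Suc (Suc d)"]
        unfolding K_def by (auto simp del: funpow.simps)
    qed (auto simp: K_def)
    then show False using min by blast
  qed
  then obtain s where s: "s \<in> F" "infinite (K s)" by blast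
  have "K s \<subseteq> {u. E s u \<and> (\<exists>w x. E u w \<and> w \<noteq> s \<and> E w x \<and> x \<noteq> u)}"
  proof
    fix u assume "u \<in> K s"
    then obtain w x where u: "u \<in> kids s" "w \<in> kids u" "x \<in> kids w" unfolding K_def by blast
    then have "\<delta> u = Suc (\<delta> s)" "\<delta> w = Suc (\<delta> u)" "\<delta> x = Suc (\<delta> w)"
      using kids_in[OF u(1)] kids_in[OF u(2)] kids_in[OF u(3)] by blast+
    then have "w \<noteq> s" "x \<noteq> u" by auto
    then show "u \<in> {u. E s u \<and> (\<exists>w x. E u w \<and> w \<noteq> s \<and> E w x \<and> x \<noteq> u)}" using u kids_edge by blast
  qed
  then have "deep_centre E s" unfolding deep_centre_def using s(2) finite_subset by blast
  then show ?thesis using s F(1) unfolding up_closed_def by blast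
qed

lemma reaches_two:
  assumes "reaches 2 F" "x \<in> V"
  shows "x \<in> F \<or> (\<delta> x \<noteq> 0 \<and> \<pi> x \<in> F) \<or> (\<delta> x \<noteq> 0 \<and> \<delta> (\<pi> x) \<noteq> 0 \<and> \<pi> (\<pi> x) \<in> F)"
proof -
  obtain k where k: "k \<le> 2" "k \<le> \<delta> x" "(\<pi> ^^ k) x \<in> F" using assms unfolding reaches_def by blast
  then consider "k = 0" | "k = 1" | "k = 2" by linarith
  then show ?thesis
    using k parent(2)[OF assms(2)] by cases (auto simp: numeral_2_eq_2)
qed

text \<open>Minimality gives some \<open>s\<close> in \<open>F\<close> with infinitely many non-leaf
  children, and strong contraction gives vertices with arbitrarily many leaves. If some vertex has
  infinitely many leaves, then either such a vertex and a centre can be chosen distinct, or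
  \<open>s\<close> is the only vertex of infinite degree. In the latter case only the degree bound
  of \<open>in_T_star\<close> can fail, and vertices of large degree are star vertices at
  \<open>s\<close>. If no vertex has infinitely many leaves, those with many are adjacent to the
  finite set \<open>F\<close>, so one element of \<open>F\<close> is a star centre.\<close>

lemma centres_if_reaches_two:
  assumes fo: "forest V E" and F: "up_closed F" "reaches 2 F"
    and min: "\<And>F. up_closed F \<Longrightarrow> \<not> reaches 1 F"
    and sc: "strongly_contracting V E" and T: "\<not> in_T_star V E"
  shows "(\<exists>s\<in>V. \<exists>t\<in>V. s \<noteq> t \<and> centre E s \<and> infinite (leaf_nbrs E t)) \<or> (\<exists>s\<in>V. star_centre E s)"
proof -
  have FV: "F \<subseteq> V" "finite F" using F(1) by (auto simp: up_closed_def)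
  have F2: "reaches (Suc 1) F" using F(2) by (simp add: numeral_2_eq_2)
  have "\<exists>s\<in>F. infinite {u\<in>kids s. kids u \<noteq> {}}"
  proof (rule ccontr)
    assume "\<not> ?thesis"
    then have "finite {u\<in>kids s. kids u \<noteq> {}}" if "s \<in> F" for s using that by blast
    then have "\<exists>F. up_closed F \<and> reaches 1 F"
    proof (rule reaches_decrease[OF F(1) F2])
      fix w assume "w \<in> V" "Suc 1 \<le> \<delta> w"
      then show "(\<pi> ^^ 1) w \<in> {u \<in> kids ((\<pi> ^^ Suc 1) w). kids u \<noteq> {}}"
        using ancestor_kid[of w 0] ancestor_kid[of w 1] by auto
    qed auto
    then show False using min by blast
  qed
  then obtain s where s: "s \<in> F" "infinite {u\<in>kids s. kids u \<noteq> {}}" by blast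
  have sV: "s \<in> V" and cs: "centre E s" using s FV centre_of_kids by auto
  have "{v\<in>V. nbhd E v = {}} \<subseteq> F"
  proof clarify
    fix v assume v: "v \<in> V" "nbhd E v = {}"
    then have "\<delta> v = 0" using parent(3)[OF v(1)] by (auto simp: nbhd_def)
    then show "v \<in> F" using reaches_two[OF F(2) v(1)] by simp
  qed
  then have unb: "\<And>n. \<exists>p\<in>V. card_ge (leaf_nbrs E p) n"
    using strongly_contracting_leaves[OF fo sc] FV finite_subset by blast
  have leaf_V: "p \<in> V" if "u \<in> leaf_nbrs E p" for u p
    using that graph by (auto simp: leaf_nbrs_def simple_graph_def)
  \<comment> \<open>A child of \<open>v\<close> is within two levels of \<open>F\<close>, but
    neither it nor \<open>v\<close> is in \<open>F\<close>.\<close>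
  have no_deep: "\<pi> v \<in> F" if "v \<in> V" "v \<notin> F" "x \<in> kids v" for v x
    using reaches_two[OF F(2), of x] kids_in[OF that(3)] that up_closed_kid[OF F(1)] by auto
  show ?thesis
  proof (cases "\<exists>t. infinite (leaf_nbrs E t)")
    case True
    then obtain t where t: "infinite (leaf_nbrs E t)" by blast
    then have tV: "t \<in> V" using leaf_V by (metis ex_in_conv finite.emptyI)
    show ?thesis
    proof (cases "t = s")
      case False
      then show ?thesis using t tV sV cs by (intro disjI1 bexI[of _ s] bexI[of _ t]) auto
    next
      case True
      then have ls: "infinite (leaf_nbrs E s)" using t by simp
      show ?thesis
      proof (cases "\<exists>s'. s' \<noteq> s \<and> (infinite (leaf_nbrs E s') \<or> centre E s')")
        case True
        then obtain s' where s': "s' \<noteq> s" "infinite (leaf_nbrs E s') \<or> centre E s'" by blast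
        then have "\<exists>u. E s' u" unfolding centre_def leaf_nbrs_def using not_finite_existsD by blast
        then have "s' \<in> V" using graph unfolding simple_graph_def by blast
        then have "\<exists>a\<in>V. \<exists>t\<in>V. a \<noteq> t \<and> centre E a \<and> infinite (leaf_nbrs E t)"
          using s' sV cs ls by metis
        then show ?thesis ..
      next
        case False
        have fin: "finite (nbhd E v)" if "v \<noteq> s" for v
        proof -
          have "nbhd E v = leaf_nbrs E v \<union> {u. E v u \<and> \<not> is_leaf E u}" by (auto simp: nbhd_def leaf_nbrs_def)
          moreover have "finite (leaf_nbrs E v)" "\<not> centre E v" using False that by blast+
          ultimately show ?thesis by (simp add: centre_def)
        qed
        have fin_kids: "finite (kids v)" if "v \<noteq> s" for v
          using fin[OF that] by (rule rev_finite_subset) (use kids_edge in \<open>auto simp: nbhd_def\<close>)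
        \<comment> \<open>Besides \<open>F\<close>, this collects what lies at most two levels below
          \<open>F\<close> without passing through \<open>s\<close>; it is finite as only
          \<open>s\<close> has infinite degree.\<close>
        define G where "G = F \<union> (\<Union>f\<in>F - {s}. kids f \<union> (\<Union>u\<in>kids f - {s}. kids u))"
        have fG: "finite G" unfolding G_def using FV fin_kids by auto
        have near_s: "w \<in> kids s \<or> (\<delta> w \<noteq> 0 \<and> \<pi> w \<in> kids s)" if w: "w \<in> V" "w \<notin> G" for w
        proof -
          have "w \<notin> F" using w by (auto simp: G_def)
          then consider "\<delta> w \<noteq> 0" "\<pi> w \<in> F" | "\<delta> w \<noteq> 0" "\<delta> (\<pi> w) \<noteq> 0" "\<pi> (\<pi> w) \<in> F"
            using reaches_two[OF F(2) w(1)] by blast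
          then show ?thesis
          proof cases
            case 1
            then have k: "w \<in> kids (\<pi> w)" using w by (simp add: kids_def)
            then show ?thesis using 1 w unfolding G_def by (cases "\<pi> w = s") auto
          next
            case 2
            then have k: "w \<in> kids (\<pi> w)" "\<pi> w \<in> kids (\<pi> (\<pi> w))"
              using w parent(1)[OF w(1)] by (auto simp: kids_def)
            show ?thesis
            proof (cases "\<pi> (\<pi> w) = s \<or> \<pi> w = s")
              case True
              then show ?thesis using k 2 by auto
            next
              case False
              then have "w \<in> G" unfolding G_def using k 2 by blast
              then show ?thesis using w by blast
            qed
          qed
        qed
        have "{v\<in>V. \<not> (v = s \<or> E s v \<or> (\<exists>w. E s w \<and> E w v))} \<subseteq> G"
        proof
          fix v assume "v \<in> {v\<in>V. \<not> (v = s \<or> E s v \<or> (\<exists>w. E s w \<and> E w v))}"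
          then have v: "v \<in> V" "\<not> (v = s \<or> E s v \<or> (\<exists>w. E s w \<and> E w v))" by simp_all
          show "v \<in> G"
          proof (rule ccontr)
            assume "v \<notin> G"
            then have "v \<in> kids s \<or> (\<delta> v \<noteq> 0 \<and> \<pi> v \<in> kids s)" using near_s v by blast
            moreover have "v \<in> kids (\<pi> v)" if "\<delta> v \<noteq> 0" using that v by (simp add: kids_def)
            ultimately show False using v(2) kids_edge by blast
          qed
        qed
        then have far: "finite {v\<in>V. \<not> (v = s \<or> E s v \<or> (\<exists>w. E s w \<and> E w v))}"
          using fG finite_subset by blast
        have inf_s: "infinite (nbhd E s)"
          using ls by (rule contrapos_nn) (auto simp: leaf_nbrs_def nbhd_def elim: rev_finite_subset)
        have big: "\<exists>v\<in>V - {s}. d < card (nbhd E v)" for d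
        proof (rule ccontr)
          assume "\<not> ?thesis"
          then have "\<forall>v\<in>V - {s}. finite (nbhd E v) \<and> card (nbhd E v) \<le> d" using fin by (auto simp: not_less)
          then have "in_T_star V E"
            unfolding in_T_star_def using fo sV inf_s far ls cs unfolding leaf_nbrs_def centre_def by blast
          then show False using T by blast
        qed
        obtain m where m: "\<And>v. v \<in> G \<Longrightarrow> card (nbhd E v) < m"
          using finite_bound[OF fG, of "\<lambda>v. card (nbhd E v)"] by blast
        have "star_centre E s"
          unfolding star_centre_def
        proof
          fix n
          \<comment> \<open>Exceeding \<open>m\<close> keeps \<open>v\<close> out of
            \<open>G\<close>, which forces it to be a child of \<open>s\<close> whose children are
            all leaves; the extra 1 allows for its parent.\<close>
          obtain v where v: "v \<in> V" "v \<noteq> s" "m + n + 1 < card (nbhd E v)" using big by auto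
          then have "v \<notin> G" using m[of v] by auto
          then have vF: "v \<notin> F" by (auto simp: G_def)
          have dv: "\<delta> v \<noteq> 0" using near_s[OF v(1) \<open>v \<notin> G\<close>] by (auto simp: kids_def)
          have nb: "nbhd E v = insert (\<pi> v) (kids v)" by (rule nbhd_nonroot[OF v(1) dv])
          have "kids v \<noteq> {}" using v(3) nb by auto
          then obtain x where "x \<in> kids v" by blast
          then have "\<pi> v \<in> F" using no_deep[OF v(1) vF] by blast
          have vs: "v \<in> kids s"
          proof (rule ccontr)
            assume "v \<notin> kids s"
            moreover have "v \<in> kids (\<pi> v)" using v dv by (simp add: kids_def)
            ultimately have "\<pi> v \<noteq> s" by auto
            then show False using \<open>\<pi> v \<in> F\<close> \<open>v \<in> kids (\<pi> v)\<close> \<open>v \<notin> G\<close> unfolding G_def by blast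
          qed
          have "kids v \<subseteq> leaf_kids v"
          proof
            fix x assume x: "x \<in> kids v"
            have "x \<notin> F" using up_closed_kid[OF F(1) x] vF by blast
            then have "kids x = {}" using no_deep[of x] kids_in[OF x] vF by blast
            then show "x \<in> leaf_kids v" using x by (simp add: leaf_kids_def)
          qed
          then have "kids v \<subseteq> leaf_nbrs E v" using leaf_kids_leaf by blast
          moreover have fl: "finite (leaf_nbrs E v)"
            using fin[OF v(2)] by (rule rev_finite_subset) (auto simp: leaf_nbrs_def nbhd_def)
          ultimately have "card (kids v) \<le> card (leaf_nbrs E v)" by (intro card_mono)
          moreover have "card (nbhd E v) \<le> Suc (card (kids v))"
            using nb fin_kids[OF v(2)] by (simp add: card_insert_if)
          ultimately have "n \<le> card (leaf_nbrs E v)" using v(3) by linarith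
          then show "\<exists>p. E s p \<and> finite (leaf_nbrs E p) \<and> n \<le> card (leaf_nbrs E p)"
            using kids_edge[OF vs] fl by blast
        qed
        then show ?thesis using sV by blast
      qed
    qed
  next
    case False
    then have fin: "finite (leaf_nbrs E p)" for p by blast
    have "\<exists>s\<in>F. star_centre E s"
    proof (rule ccontr)
      assume "\<not> ?thesis"
      then have "\<exists>n. \<forall>p. E f p \<longrightarrow> card (leaf_nbrs E p) < n" if "f \<in> F" for f
        using that fin unfolding star_centre_def by (metis not_le)
      then obtain n where n: "\<And>f p. f \<in> F \<Longrightarrow> E f p \<Longrightarrow> card (leaf_nbrs E p) < n f" by metis
      obtain m1 where m1: "\<And>f. f \<in> F \<Longrightarrow> n f < m1" using finite_bound[OF FV(2), of n] by blast
      obtain m2 where m2: "\<And>f. f \<in> F \<Longrightarrow> card (leaf_nbrs E f) < m2"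
        using finite_bound[OF FV(2), of "\<lambda>f. card (leaf_nbrs E f)"] by blast
      \<comment> \<open>The summand \<open>m2\<close> keeps \<open>p\<close> outside
        \<open>F\<close>, and \<open>m1\<close> contradicts the bound for neighbours of
        \<open>F\<close>. The extra 2 ensures a leaf other than the parent of \<open>p\<close>,
        hence a child.\<close>
      obtain p where p: "p \<in> V" "m1 + m2 + 2 \<le> card (leaf_nbrs E p)"
        using unb[of "m1 + m2 + 2"] fin by (auto simp: card_ge_def)
      then have pF: "p \<notin> F" using m2[of p] by auto
      have "\<not> leaf_nbrs E p \<subseteq> {\<pi> p}"
      proof
        assume "leaf_nbrs E p \<subseteq> {\<pi> p}"
        then have "card (leaf_nbrs E p) \<le> 1" using card_mono[of "{\<pi> p}"] by simp
        then show False using p by simp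
      qed
      then obtain x where x: "x \<in> kids p" using leaf_nbrs_subset[of p] by (auto simp: leaf_kids_def)
      have "\<pi> p \<in> F" using no_deep[OF p(1) pF x] .
      moreover have "\<delta> p \<noteq> 0" using reaches_two[OF F(2) p(1)] pF by auto
      moreover have "E (\<pi> p) p" using parent(3)[OF p(1) \<open>\<delta> p \<noteq> 0\<close>] graph unfolding simple_graph_def by blast
      ultimately have "card (leaf_nbrs E p) < m1" using n m1 less_trans by blast
      then show False using p by simp
    qed
    then show ?thesis using FV by blast
  qed
qed

text \<open>The induction brings the radius down to the least possible one. Radius at most 1 would
  give a finite dominating set, radius 2 gives two centres or a star centre, and a larger radius a
  deep centre.\<close>

lemma forest_classification:
  assumes fo: "forest V E" and F: "up_closed F" "reaches d F"
    and dom: "\<not> has_finite_dominating_set V E"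
    and sc: "strongly_contracting V E" and T: "\<not> in_T_star V E"
  shows "(\<exists>s\<in>V. deep_centre E s) \<or> (\<exists>s\<in>V. \<exists>t\<in>V. s \<noteq> t \<and> centre E s \<and> infinite (leaf_nbrs E t))
      \<or> (\<exists>s\<in>V. star_centre E s)"
  using F
proof (induction d arbitrary: F)
  case 0
  then have "reaches 1 F" unfolding reaches_def by force
  then show ?case using dominating_if_reaches 0 dom by blast
next
  case (Suc d)
  show ?case
  proof (cases "\<exists>F. up_closed F \<and> reaches d F")
    case True
    then show ?thesis using Suc.IH by blast
  next
    case False
    have "d \<noteq> 0" using dominating_if_reaches[OF Suc.prems(1)] Suc.prems(2) dom by (metis One_nat_def)
    then consider "d = 1" | e where "d = Suc (Suc e)" by (metis One_nat_def not0_implies_Suc)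
    then show ?thesis
    proof cases
      case 1
      then have "reaches 2 F" using Suc.prems(2) by (simp add: numeral_2_eq_2)
      then show ?thesis
        using centres_if_reaches_two[OF fo Suc.prems(1) _ _ sc T] False 1 by blast
    next
      case 2
      then show ?thesis using deep_centre_if_reaches[of F e] Suc.prems False by blast
    qed
  qed
qed

end

section \<open>The cofinite copy\<close>

lemma mono_copy_if_spans:
  assumes "simple_graph V E" "spans V E (adj c b) M X" "M \<subseteq> {1..}" "finite ({1..} - X)"
  shows "\<exists>f. mono_copy V E c f \<and> finite ({1..} - f ` V)"
proof -
  obtain f where f: "inj_on f V" "f ` V \<subseteq> M" "\<And>u v. E u v \<Longrightarrow> adj c b (f u) (f v)" "X \<subseteq> f ` V"
    using assms(2) unfolding spans_def by blast
  have "mono_copy V E c f"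
    unfolding mono_copy_def using f assms(3) by (auto simp: adj_def)
  moreover have "finite ({1..} - f ` V)"
    using assms(4) by (rule rev_finite_subset) (use f(4) in auto)
  ultimately show ?thesis by blast
qed

section \<open>Rerooting the forest at a centre\<close>

lemma rooted_forest_at:
  assumes "forest V E" "countable V" "s \<in> V"
  obtains \<pi> \<delta> where "rooted_forest V E \<pi> \<delta>" "\<delta> s = 0"
proof -
  obtain \<pi> \<delta> where "rooting V E \<pi> \<delta>" "\<delta> s = 0" using forest_rooting[OF assms(1,3)] .
  moreover have "simple_graph V E" using assms(1) by (simp add: forest_def)
  ultimately show thesis using assms(2) by (intro that[of \<pi> \<delta>] rooted_forest.intro) auto
qed

lemma (in rooted_forest) centre_kids:
  assumes "\<delta> s = 0" "centre E s"
  shows "infinite {u\<in>kids s. kids u \<noteq> {}}"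
proof -
  have "{u. E s u \<and> \<not> is_leaf E u} \<subseteq> {u\<in>kids s. kids u \<noteq> {}}"
  proof
    fix u assume "u \<in> {u. E s u \<and> \<not> is_leaf E u}"
    then have u: "u \<in> kids s" "\<not> is_leaf E u" using nbhd_root[OF assms(1)] by (auto simp: nbhd_def)
    have "nbhd E u = insert s (kids u)" using nbhd_nonroot[of u] kids_in[OF u(1)] by simp
    then show "u \<in> {u\<in>kids s. kids u \<noteq> {}}" using u by (auto simp: is_leaf_def)
  qed
  then show ?thesis using assms(2) unfolding centre_def by (meson finite_subset)
qed

lemma (in rooted_forest) deep_centre_kids:
  assumes "\<delta> s = 0" "deep_centre E s"
  shows "infinite {u\<in>kids s. \<exists>w\<in>kids u. kids w \<noteq> {}}"
proof -
  have "{u. E s u \<and> (\<exists>w x. E u w \<and> w \<noteq> s \<and> E w x \<and> x \<noteq> u)} \<subseteq> {u\<in>kids s. \<exists>w\<in>kids u. kids w \<noteq> {}}"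
  proof
    fix u assume "u \<in> {u. E s u \<and> (\<exists>w x. E u w \<and> w \<noteq> s \<and> E w x \<and> x \<noteq> u)}"
    then obtain w x where u: "E s u" "E u w" "w \<noteq> s" "E w x" "x \<noteq> u" by blast
    then have su: "u \<in> kids s" using nbhd_root[OF assms(1)] by (auto simp: nbhd_def)
    have uw: "w \<in> kids u" using edge_cases[OF u(2)] su u(3) by (auto simp: kids_def)
    have "x \<in> kids w" using edge_cases[OF u(4)] uw u(5) by (auto simp: kids_def)
    then show "u \<in> {u\<in>kids s. \<exists>w\<in>kids u. kids w \<noteq> {}}" using su uw by blast
  qed
  then show ?thesis using assms(2) unfolding deep_centre_def by (meson finite_subset)
qed

lemma (in rooted_forest) infinite_leaf_kids:
  assumes "infinite (leaf_nbrs E t)"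
  shows "infinite (leaf_kids t)"
  using assms leaf_nbrs_subset[of t] by (meson finite_insert finite_subset)

lemma (in rooted_forest) leaf_kids_large:
  assumes "finite (leaf_nbrs E p)" "Suc n \<le> card (leaf_nbrs E p)"
  shows "\<exists>L\<subseteq>leaf_kids p. finite L \<and> card L = n"
proof -
  have fin: "finite (leaf_kids p)" using assms(1) leaf_kids_leaf finite_subset by blast
  have "card (leaf_nbrs E p) \<le> card (insert (\<pi> p) (leaf_kids p))"
    using leaf_nbrs_subset fin by (intro card_mono) auto
  also have "\<dots> \<le> Suc (card (leaf_kids p))" using fin by (simp add: card_insert_if)
  finally have "n \<le> card (leaf_kids p)" using assms(2) by simp
  then show ?thesis using fin by (metis obtain_subset_with_card_n)
qed

lemma (in rooted_forest) star_centre_kids: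
  assumes "\<delta> s = 0" "star_centre E s" "finite F"
  shows "\<exists>p\<in>kids s - F. \<exists>L\<subseteq>leaf_kids p. finite L \<and> card L = n"
proof -
  \<comment> \<open>A vertex with more leaves than any vertex of \<open>F\<close> lies outside
    \<open>F\<close>.\<close>
  obtain m where m: "\<And>p. p \<in> F \<Longrightarrow> card (leaf_nbrs E p) < m"
    using finite_bound[OF assms(3), of "\<lambda>p. card (leaf_nbrs E p)"] by blast
  obtain p where p: "E s p" "finite (leaf_nbrs E p)" "m + Suc n \<le> card (leaf_nbrs E p)"
    using assms(2) unfolding star_centre_def by blast
  then have "p \<in> kids s - F" using nbhd_root[OF assms(1)] m[of p] by (auto simp: nbhd_def)
  then show ?thesis using leaf_kids_large[OF p(2), of n] p(3) by auto
qed

text \<open>Ramsey's theorem gives an infinite monochromatic clique \<open>H\<close> of integers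
  with finite degree in colour \<open>\<not> b\<close>. Its colour is \<open>b\<close>, since
  otherwise its members would have infinite degree in \<open>\<not> b\<close>. Vertices with
  children go into \<open>H\<close>; isolated vertices or leaves cover almost all integers.\<close>

lemma cofinite_copy_few_exceptions:
  assumes fo: "forest V E" "countable V" and V: "V \<noteq> {}" and sc: "strongly_contracting V E"
    and inf: "infinite {x\<in>{1..}. finite {y\<in>{1..}. adj c (\<not> b) x y}}"
  shows "\<exists>f. mono_copy V E c f \<and> finite ({1..} - f ` V)"
proof -
  define M :: "nat set" where "M = {1..}"
  have gr: "simple_graph V E" using fo by (simp add: forest_def)
  have finish: ?thesis if "spans V E (adj c b) M X" "finite (M - X)" for X
    using mono_copy_if_spans[OF gr that(1)] that(2) by (simp add: M_def)
  define Z where "Z = {x\<in>M. finite {y\<in>M. adj c (\<not> b) x y}}"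
  have infZ: "infinite Z" using inf by (simp add: Z_def M_def)
  \<comment> \<open>\<open>Ramsey2\<close> expects natural numbers as colours.\<close>
  define k where "k S = (if c S then 1 else 0 :: nat)" for S
  have "\<forall>x\<in>Z. \<forall>y\<in>Z. x \<noteq> y \<longrightarrow> k {x, y} < 2" by (simp add: k_def)
  from Ramsey2[OF infZ this] obtain H t where H: "H \<subseteq> Z" "infinite H"
    and t: "\<forall>x\<in>H. \<forall>y\<in>H. x \<noteq> y \<longrightarrow> k {x, y} = t"
    by blast
  have mono: "c {x, y} = c {x, z}" if "x \<in> H" "y \<in> H" "z \<in> H" "x \<noteq> y" "x \<noteq> z" for x y z
  proof -
    have "k {x, y} = k {x, z}" using t that by metis
    then show ?thesis by (simp add: k_def split: if_splits)
  qed
  have clique: "adj c b x y" if "x \<in> H" "y \<in> H" "x \<noteq> y" for x y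
  proof (rule ccontr)
    assume "\<not> adj c b x y"
    then have "c {x, y} = (\<not> b)" using that(3) by (auto simp: adj_def)
    then have "H - {x} \<subseteq> {y\<in>M. adj c (\<not> b) x y}"
      using mono[OF that(1,2) _ that(3)] H(1) by (auto simp: adj_def Z_def)
    moreover have "finite {y\<in>M. adj c (\<not> b) x y}" using that(1) H(1) by (auto simp: Z_def)
    ultimately have "finite (H - {x})" by (rule finite_subset)
    then show False using H(2) by simp
  qed
  have exc: "finite {y\<in>M. \<not> adj c b h y}" if "h \<in> H" for h
  proof (rule finite_subset)
    show "{y\<in>M. \<not> adj c b h y} \<subseteq> insert h {y\<in>M. adj c (\<not> b) h y}" by (auto simp: adj_def)
    show "finite (insert h {y\<in>M. adj c (\<not> b) h y})" using that H(1) by (auto simp: Z_def)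
  qed
  have host: "hosted_forest V E \<pi> \<delta> (adj c b) M H" if "rooted_forest V E \<pi> \<delta>" for \<pi> \<delta>
  proof -
    have "infinite {y\<in>H. adj c b h y}" if "h \<in> H" for h
    proof -
      have "H - {h} \<subseteq> {y\<in>H. adj c b h y}" using clique[OF that] by auto
      then show ?thesis using H(2) by (meson finite_Diff2 finite.emptyI finite_insert finite_subset)
    qed
    moreover have "H \<subseteq> M" using H(1) by (auto simp: Z_def)
    ultimately show ?thesis
      using that H(2) adj_sym by (intro hosted_forest.intro hosted_forest_axioms.intro) auto
  qed
  obtain h where h: "h \<in> H" using infinite_imp_nonempty[OF H(2)] by blast
  consider (isolated) "infinite {v\<in>V. nbhd E v = {}}" | (star) t where "infinite (leaf_nbrs E t)"
    | (stars) "\<And>p. finite (leaf_nbrs E p)" "\<And>n. \<exists>p\<in>V. card_ge (leaf_nbrs E p) n"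
    using strongly_contracting_leaves[OF fo(1) sc] by blast
  then show ?thesis
  proof cases
    case isolated
    obtain \<pi> \<delta> where "rooted_forest V E \<pi> \<delta>" using rooted_forest_at[OF fo] V by blast
    then interpret hosted_forest V E \<pi> \<delta> "adj c b" M H by (rule host)
    show ?thesis by (rule finish[OF spans_isolated[OF isolated]]) simp
  next
    case (star t)
    then have tV: "t \<in> V" using gr infinite_imp_nonempty[OF star] by (auto simp: leaf_nbrs_def simple_graph_def)
    obtain \<pi> \<delta> where r: "rooted_forest V E \<pi> \<delta>" "\<delta> t = 0" using rooted_forest_at[OF fo tV] .
    then interpret hosted_forest V E \<pi> \<delta> "adj c b" M H by (intro host)
    have "M - {x\<in>M. adj c b h x} = {x\<in>M. \<not> adj c b h x}" by auto
    then show ?thesis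
      using finish[OF spans_infinite_star[OF tV r(2) infinite_leaf_kids[OF star] h]] exc[OF h] by simp
  next
    case stars
    obtain \<pi> \<delta> where r: "rooted_forest V E \<pi> \<delta>" using rooted_forest_at[OF fo] V by blast
    then interpret hosted_forest V E \<pi> \<delta> "adj c b" M H by (rule host)
    have "\<exists>p\<in>V - F. \<exists>L\<subseteq>leaf_kids p. finite L \<and> card L = n" if F: "finite F" for n F
    proof -
      obtain m where m: "\<And>p. p \<in> F \<Longrightarrow> card (leaf_nbrs E p) < m"
        using finite_bound[OF F, of "\<lambda>p. card (leaf_nbrs E p)"] by blast
      obtain p where p: "p \<in> V" "m + Suc n \<le> card (leaf_nbrs E p)"
        using stars(2)[of "m + Suc n"] stars(1) by (auto simp: card_ge_def)
      then have "p \<in> V - F" using m[of p] by auto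
      then show ?thesis using leaf_kids_large[OF stars(1)[of p], of n] p(2) by auto
    qed
    then obtain X0 where X0: "finite X0" "spans V E (adj c b) M (M - X0)"
      using spans_unbounded_stars[OF clique exc] by blast
    then show ?thesis by (intro finish[OF X0(2)]) (auto intro: finite_subset[OF _ X0(1)])
  qed
qed

text \<open>An arbitrary rooting decides between unbounded depth and the three types of centre. In
  the latter case the forest is rerooted at the centre, and finiteness of the sets
  \<open>miss b v\<close> for one fixed \<open>v\<close> decides which construction applies.\<close>

lemma cofinite_copy_infinite_degrees:
  assumes fo: "forest V E" "countable V" and sc: "strongly_contracting V E"
    and dom: "\<not> has_finite_dominating_set V E" and T: "\<not> in_T_star V E"
    and M: "M \<noteq> {}" "M \<subseteq> {1..}" "finite ({1..} - M)"
    and deg: "\<And>x b. x \<in> M \<Longrightarrow> infinite {y\<in>M. adj c b x y}"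
  shows "\<exists>f. mono_copy V E c f \<and> finite ({1..} - f ` V)"
proof -
  have gr: "simple_graph V E" using fo by (simp add: forest_def)
  have finish: ?thesis if X0: "\<exists>b X0. finite X0 \<and> spans V E (adj c b) M (M - X0)"
  proof -
    obtain b X0 where X0: "finite X0" "spans V E (adj c b) M (M - X0)" using X0 by blast
    have "{1..} - (M - X0) \<subseteq> ({1..} - M) \<union> X0" by auto
    then have "finite ({1..} - (M - X0))" using M(3) X0(1) by (meson finite_UnI finite_subset)
    then show ?thesis using mono_copy_if_spans[OF gr X0(2) M(2)] by blast
  qed
  have V: "V \<noteq> {}" using dom unfolding has_finite_dominating_set_def dominating_def by auto
  have col: "coloured_forest V E \<pi> \<delta> c M" if "rooted_forest V E \<pi> \<delta>" for \<pi> \<delta>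
    using that M(1) deg by (intro coloured_forest.intro coloured_forest_axioms.intro)
  obtain v where v: "v \<in> M" using M(1) by blast
  have reroot: "\<exists>\<pi> \<delta>. coloured_forest V E \<pi> \<delta> c M \<and> rooted_forest V E \<pi> \<delta> \<and> \<delta> s = 0" if "s \<in> V" for s
    using rooted_forest_at[OF fo that] col by metis
  obtain \<pi>0 \<delta>0 where r0: "coloured_forest V E \<pi>0 \<delta>0 c M" "rooted_forest V E \<pi>0 \<delta>0"
    using reroot V by blast
  \<comment> \<open>If one of the two missed sets is finite, a single centre at \<open>v\<close>
    suffices.\<close>
  have small: ?thesis if s: "s \<in> V" "centre E s" and col: "coloured_forest V E \<pi> \<delta> c M" "\<delta> s = 0"
    and fin: "finite (coloured_forest.miss c M b v)" for s \<pi> \<delta> b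
  proof -
    interpret coloured_forest V E \<pi> \<delta> c M by (rule col)
    show ?thesis
      using spans_one_centre[OF s(1) col(2) centre_kids[OF col(2) s(2)] v, of b] fin finish by blast
  qed
  show ?thesis
  proof (cases "\<exists>d F. rooted_forest.up_closed V \<pi>0 \<delta>0 F \<and> rooted_forest.reaches V \<pi>0 \<delta>0 d F")
    case False
    then show ?thesis using coloured_forest.spans_unbounded_depth[OF r0(1)] finish by blast
  next
    case True
    then obtain d F where dF: "rooted_forest.up_closed V \<pi>0 \<delta>0 F" "rooted_forest.reaches V \<pi>0 \<delta>0 d F" by blast
    consider (deep) s where "s \<in> V" "deep_centre E s"
      | (two) s t where "s \<in> V" "t \<in> V" "s \<noteq> t" "centre E s" "infinite (leaf_nbrs E t)"
      | (stars) s where "s \<in> V" "star_centre E s"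
      using rooted_forest.forest_classification[OF r0(2) fo(1) dF dom sc T] by blast
    then show ?thesis
    proof cases
      case deep
      obtain \<pi> \<delta> where r: "coloured_forest V E \<pi> \<delta> c M" "\<delta> s = 0" using reroot[OF deep(1)] by blast
      interpret coloured_forest V E \<pi> \<delta> c M by (rule r)
      have dk: "infinite {u\<in>kids s. \<exists>w\<in>kids u. kids w \<noteq> {}}" by (rule deep_centre_kids[OF r(2) deep(2)])
      then have "infinite {u\<in>kids s. kids u \<noteq> {}}" by (rule contrapos_nn) (auto elim: rev_finite_subset)
      then have "centre E s" by (rule centre_of_kids)
      then show ?thesis
        using small[OF deep(1) _ r, of False] spans_deep[OF deep(1) r(2) dk v, of True] finish
        by (metis Diff_empty finite.emptyI)
    next
      case two
      obtain \<pi> \<delta> where r: "coloured_forest V E \<pi> \<delta> c M" "\<delta> s = 0" using reroot[OF two(1)] by blast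
      interpret coloured_forest V E \<pi> \<delta> c M by (rule r)
      show ?thesis
      proof (cases "\<exists>b. finite (miss b v)")
        case True
        then show ?thesis using small[OF two(1,4) r] by blast
      next
        case False
        then show ?thesis
          using spans_star_and_centre[OF two(1) r(2) centre_kids[OF r(2) two(4)] two(2) two(3)[symmetric]
            infinite_leaf_kids[OF two(5)] v] finish by blast
      qed
    next
      case stars
      obtain \<pi> \<delta> where r: "coloured_forest V E \<pi> \<delta> c M" "\<delta> s = 0" using reroot[OF stars(1)] by blast
      interpret coloured_forest V E \<pi> \<delta> c M by (rule r)
      have sk: "\<exists>p\<in>kids s - F. \<exists>L\<subseteq>leaf_kids p. finite L \<and> card L = n" if "finite F" for n F
        by (rule star_centre_kids[OF r(2) stars(2) that])
      \<comment> \<open>If this set were finite, \<open>sk\<close> would supply a child of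
        \<open>s\<close> outside it that still has a leaf below it.\<close>
      have ck: "infinite {u\<in>kids s. kids u \<noteq> {}}"
      proof
        assume "finite {u\<in>kids s. kids u \<noteq> {}}"
        from sk[OF this, of 1] obtain p L where "p \<in> kids s" "kids p = {}" "L \<subseteq> leaf_kids p" "card L = 1" by auto
        then show False by (auto simp: leaf_kids_def)
      qed
      show ?thesis
        using small[OF stars(1) centre_of_kids[OF ck] r, of False]
          spans_star_children[OF stars(1) r(2) ck v sk, of True] finish by auto
    qed
  qed
qed

lemma ramsey_cofinite_forest:
  assumes fo: "forest V E" "countable V" and sc: "strongly_contracting V E"
    and dom: "\<not> has_finite_dominating_set V E" and T: "\<not> in_T_star V E"
  shows "ramsey_cofinite V E"
  unfolding ramsey_cofinite_def
proof
  fix c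
  define Z where "Z b = {x\<in>{1..}. finite {y\<in>{1..}. adj c b x y}}" for b
  have V: "V \<noteq> {}" using dom unfolding has_finite_dominating_set_def dominating_def by auto
  show "\<exists>f. mono_copy V E c f \<and> finite ({1..} - f ` V)"
  proof (cases "\<exists>b. infinite (Z b)")
    case True
    \<comment> \<open>The lemma applied next assumes finite degrees in the colour opposite to that
      of the copy, so it is used for the colour \<open>\<not> b\<close>.\<close>
    then obtain b where "infinite (Z (\<not> \<not> b))" by auto
    then show ?thesis unfolding Z_def by (rule cofinite_copy_few_exceptions[OF fo V sc])
  next
    case False
    then have fin: "finite (Z True \<union> Z False)" by simp
    let ?M = "{1..} - (Z True \<union> Z False)"
    show ?thesis
    proof (rule cofinite_copy_infinite_degrees[OF fo sc dom T, where M = ?M])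
      have "infinite ?M" using fin infinite_Ici by (intro Diff_infinite_finite)
      then show "?M \<noteq> {}" by (rule infinite_imp_nonempty)
      have "{1..} - ?M \<subseteq> Z True \<union> Z False" by auto
      then show "finite ({1..} - ?M)" using fin finite_subset by blast
      fix x b assume x: "x \<in> ?M"
      then have "infinite {y\<in>{1..}. adj c b x y}" by (cases b) (auto simp: Z_def)
      then have "infinite ({y\<in>{1..}. adj c b x y} - (Z True \<union> Z False))" using fin by simp
      moreover have "{y\<in>{1..}. adj c b x y} - (Z True \<union> Z False) = {y\<in>?M. adj c b x y}" by auto
      ultimately show "infinite {y\<in>?M. adj c b x y}" by simp
    qed auto
  qed
qed

theorem mainTheorem6:
  fixes V :: "'a set" and E :: "'a \<Rightarrow> 'a \<Rightarrow> bool"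
  assumes "forest V E" and "countable V"
  shows "(strongly_contracting V E \<and> \<not> has_finite_dominating_set V E \<and> \<not> in_T_star V E
            \<longrightarrow> ramsey_cofinite V E)
       \<and> (weakly_expanding V E \<or> has_finite_dominating_set V E \<or> in_T_star V E
            \<longrightarrow> \<not> ramsey_lower_dense V E \<and> \<not> ramsey_cofinite V E)"
proof -
  have "simple_graph V E" using assms(1) by (simp add: forest_def)
  then show ?thesis
    using ramsey_cofinite_forest[OF assms] weakly_expanding_not_lower_dense finite_dominating_not_lower_dense
      T_star_not_lower_dense ramsey_cofinite_imp_lower_dense by blast
qed

end
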